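(* Let $d=2$ and $\mathcal{R}=\{(1,1),(-1,1)\}\subset\mathbb{Z}^2$, and consider space-time random walk in a uniformly elliptic, i.i.d. random environment on $\mathbb{Z}^{2}$ (dimension $1+1$) with step set $\mathcal{R}$. Let $I_q$ and $I_a$ be the quenched and averaged large deviation rate functions of $X_n/n$ and let $\xi_o$ be the law of large numbers velocity. Then $$I_q(\xi)=I_a(\xi)<\infty\quad\text{if and only if}\quad \xi=\xi_o.$$
   Context: Environment: $\omega=(\omega_x)_{x\in\mathbb{Z}^2}$, where each $\omega_x=(\pi(x,x+z))_{z\in\mathcal{R}}$ is a probability vector on $\mathcal{R}$. $\mathbb{P}$ is a probability measure on the space $\Omega$ of environments (with Borel product $\sigma$-algebra) under which the $\omega_x$, $x\in\mathbb{Z}^2$, are independent and identically distributed. Uniform ellipticity: there is $\kappa>0$ with $\mathbb{P}(\pi(0,z)\ge\kappa)=1$ for each $z\in\mathcal{R}$. For fixed $\omega$, $P_x^\omega$ is the law of the Markov chain $(X_n)_{n\ge0}$ on $\mathbb{Z}^2$ started at $x$ with transition probabilities $\pi(y,y+z)$; the averaged law is $P_x(\cdot)=\int P_x^\omega(\cdot)\,\mathbb{P}(d\omega)$; $P_o^\omega,P_o$ denote start at the origin. $I_q$ is the (deterministic, convex, lower semicontinuous) rate function $\mathbb{R}^2\to[0,\infty]$ such that for $\mathbb{P}$-a.e. $\omega$ the laws $P_o^\omega(X_n/n\in\cdot)$ satisfy the large deviation principle (LDP) with rate $I_q$; $I_a$ is the convex, lower semicontinuous rate function such that $P_o(X_n/n\in\cdot)$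 satisfies the LDP with rate $I_a$. (Both LDPs are known to hold.) Here the laws $Q_n$ satisfy the LDP with rate $I$ if $-\inf_{G^o}I\le\liminf\frac1n\log Q_n(G)\le\limsup\frac1n\log Q_n(G)\le-\inf_{\bar G}I$ for all measurable $G$, where $G^o$ and $\bar G$ are the interior and closure of $G$. The LLN velocity is $\xi_o=\lim_n X_n/n$ ($P_o$-a.s.), i.e. $\xi_o=\sum_{z\in\mathcal{R}}z\,\mathbb{E}[\pi(0,z)]$, where $\mathbb{E}$ is expectation under $\mathbb{P}$.
   Formalization: The environment is additionally assumed not to be almost surely constant; for a constant environment the quenched and averaged laws coincide, so I_q = I_a < ∞ on the whole segment {(v,1): |v| ≤ 1} and the claim fails. *)

theory Defs
  imports "HOL-Probability.Probability"
begin

type_synonym site = "int \<times> int"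

text \<open>An environment maps a site \<open>x\<close> and a step \<open>z\<close> to \<open>\<pi>(x, x + z)\<close>.\<close>
type_synonym env = "site \<Rightarrow> site \<Rightarrow> real"

definition steps :: "site set" where
  "steps = {(1, 1), (-1, 1)}"

definition prob_vectors :: "(site \<Rightarrow> real) set" where
  "prob_vectors = {p \<in> extensional steps. (\<forall>z\<in>steps. 0 \<le> p z) \<and> (\<Sum>z\<in>steps. p z) = 1}"

definition prob_vector_space :: "(site \<Rightarrow> real) measure" where
  "prob_vector_space = restrict_space (\<Pi>\<^sub>M z\<in>steps. borel) prob_vectors"

definition env_space :: "env measure" where
  "env_space = (\<Pi>\<^sub>M x\<in>UNIV. prob_vector_space)"

definition iid_environment :: "env measure \<Rightarrow> bool" where
  "iid_environment P \<longleftrightarrow>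
     prob_space P \<and> sets P = sets env_space \<and>
     prob_space.indep_vars P (\<lambda>_. prob_vector_space) (\<lambda>x \<omega>. \<omega> x) UNIV \<and>
     (\<forall>x. distr P prob_vector_space (\<lambda>\<omega>. \<omega> x) = distr P prob_vector_space (\<lambda>\<omega>. \<omega> 0))"

definition uniformly_elliptic :: "env measure \<Rightarrow> bool" where
  "uniformly_elliptic P \<longleftrightarrow> (\<exists>\<kappa>>0. \<forall>z\<in>steps. AE \<omega> in P. \<kappa> \<le> \<omega> 0 z)"

text \<open>In the i.i.d. case this says that the environment is almost surely one fixed homogeneous one,
  so that the quenched and averaged laws coincide.\<close>
definition deterministic :: "env measure \<Rightarrow> bool" where
  "deterministic P \<longleftrightarrow> (\<exists>p. AE \<omega> in P. \<omega> 0 = p)"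

abbreviation path_space :: "(nat \<Rightarrow> site) measure" where
  "path_space \<equiv> (\<Pi>\<^sub>M n\<in>UNIV. count_space UNIV)"

definition jump :: "env \<Rightarrow> site \<Rightarrow> site measure" where
  "jump \<omega> y = distr (point_measure steps (\<lambda>z. ennreal (\<omega> y z))) (count_space UNIV) (\<lambda>z. y + z)"

text \<open>The law of \<open>X n\<close> given \<open>X 0, \<dots>, X (n - 1)\<close>, for the walk started at \<open>x\<close>.\<close>
primrec walk_kernel :: "env \<Rightarrow> site \<Rightarrow> nat \<Rightarrow> (nat \<Rightarrow> site) \<Rightarrow> site measure" where
  "walk_kernel \<omega> x 0 w = return (count_space UNIV) x"
| "walk_kernel \<omega> x (Suc n) w = jump \<omega> (w n)"

definition quenched_law :: "env \<Rightarrow> site \<Rightarrow> (nat \<Rightarrow> site) measure" where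
  "quenched_law \<omega> x =
     projective_family.lim UNIV (Ionescu_Tulcea.CI (walk_kernel \<omega> x) (\<lambda>_. count_space UNIV))
       (\<lambda>_. count_space UNIV)"


lemma finite_steps [simp]: "finite steps"
  by (simp add: steps_def)

lemma space_prob_vector_space: "space prob_vector_space = prob_vectors"
  by (auto simp: prob_vector_space_def prob_vectors_def space_restrict_space space_PiM PiE_def)

lemma measurable_env_apply: "z \<in> steps \<Longrightarrow> (\<lambda>\<omega>. \<omega> y z) \<in> borel_measurable env_space"
proof -
  assume z: "z \<in> steps"
  have "(\<lambda>\<omega>. \<omega> y) \<in> env_space \<rightarrow>\<^sub>M prob_vector_space"
    unfolding env_space_def by (rule measurable_component_singleton) simp
  moreover have "(\<lambda>p. p z) \<in> borel_measurable prob_vector_space"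
    unfolding prob_vector_space_def
    by (intro measurable_restrict_space1 measurable_component_singleton z)
  ultimately show ?thesis by (rule measurable_compose)
qed

lemma env_space_prob_vector: "\<omega> \<in> space env_space \<Longrightarrow> \<omega> y \<in> prob_vectors"
  by (auto simp: env_space_def space_PiM space_prob_vector_space)

lemma emeasure_jump:
  "emeasure (jump \<omega> y) A = (\<Sum>z\<in>{z\<in>steps. y + z \<in> A}. ennreal (\<omega> y z))"
proof -
  have "emeasure (jump \<omega> y) A = emeasure (point_measure steps (\<lambda>z. ennreal (\<omega> y z))) {z\<in>steps. y + z \<in> A}"
    unfolding jump_def
    by (subst emeasure_distr) (auto simp: space_point_measure intro!: arg_cong[where f="emeasure _"])
  also have "\<dots> = (\<Sum>z\<in>{z\<in>steps. y + z \<in> A}. ennreal (\<omega> y z))"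
    by (rule emeasure_point_measure_finite) auto
  finally show ?thesis .
qed

lemma sets_jump [simp]: "sets (jump \<omega> y) = UNIV"
  and space_jump [simp]: "space (jump \<omega> y) = UNIV"
  by (simp_all add: jump_def)

lemma prob_space_jump:
  assumes "\<omega> \<in> space env_space" shows "prob_space (jump \<omega> y)"
proof
  show "emeasure (jump \<omega> y) (space (jump \<omega> y)) = 1"
    using env_space_prob_vector[OF assms, of y]
    by (simp add: emeasure_jump prob_vectors_def sum_ennreal)
qed

lemma measurable_jump: "(\<lambda>\<omega>. jump \<omega> y) \<in> env_space \<rightarrow>\<^sub>M subprob_algebra (count_space UNIV)"
proof (rule measurable_subprob_algebra)
  show "(\<lambda>\<omega>. emeasure (jump \<omega> y) A) \<in> borel_measurable env_space" for A
    unfolding emeasure_jump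
    by (intro borel_measurable_sum measurable_compose[OF _ measurable_ennreal] measurable_env_apply) auto
qed (auto intro: prob_space_imp_subprob_space prob_space_jump)

lemma measurable_walk_kernel:
  "(\<lambda>(\<omega>, w). walk_kernel \<omega> x n w) \<in>
     env_space \<Otimes>\<^sub>M (\<Pi>\<^sub>M i\<in>{0..<n}. count_space UNIV) \<rightarrow>\<^sub>M subprob_algebra (count_space UNIV)"
proof (cases n)
  case 0
  then show ?thesis
    by (simp add: case_prod_beta space_subprob_algebra prob_space_imp_subprob_space prob_space_return)
next
  case (Suc m)
  have "(\<lambda>p. jump (fst p) (snd p m)) \<in>
     env_space \<Otimes>\<^sub>M (\<Pi>\<^sub>M i\<in>{0..<n}. count_space UNIV) \<rightarrow>\<^sub>M subprob_algebra (count_space UNIV)"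
  proof (rule measurable_compose_countable[where g = "\<lambda>p. snd p m"])
    show "(\<lambda>p. jump (fst p) y) \<in>
      env_space \<Otimes>\<^sub>M (\<Pi>\<^sub>M i\<in>{0..<n}. count_space UNIV) \<rightarrow>\<^sub>M subprob_algebra (count_space UNIV)" for y
      by (rule measurable_compose[OF measurable_fst measurable_jump])
    show "(\<lambda>p. snd p m) \<in> env_space \<Otimes>\<^sub>M (\<Pi>\<^sub>M i\<in>{0..<n}. count_space UNIV) \<rightarrow>\<^sub>M count_space UNIV"
      by (rule measurable_compose[OF measurable_snd measurable_component_singleton]) (simp add: Suc)
  qed
  then show ?thesis by (simp add: Suc case_prod_beta)
qed

lemma Ionescu_Tulcea_walk:
  assumes \<omega>: "\<omega> \<in> space env_space"
  shows "Ionescu_Tulcea (walk_kernel \<omega> x) (\<lambda>_. count_space UNIV)"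
proof (rule Ionescu_Tulcea.intro)
  show "walk_kernel \<omega> x n \<in> (\<Pi>\<^sub>M i\<in>{0..<n}. count_space UNIV) \<rightarrow>\<^sub>M subprob_algebra (count_space UNIV)" for n
    using measurable_compose[OF measurable_Pair1'[OF \<omega>] measurable_walk_kernel[of x n]] by simp
  show "prob_space (walk_kernel \<omega> x n w)" for n w
    using \<omega> by (cases n) (auto intro: prob_space_return prob_space_jump)
qed

lemma sets_quenched_law:
  assumes \<omega>: "\<omega> \<in> space env_space"
  shows "sets (quenched_law \<omega> x) = sets path_space"
proof -
  interpret IT: Ionescu_Tulcea "walk_kernel \<omega> x" "\<lambda>_. count_space UNIV"
    by (rule Ionescu_Tulcea_walk[OF \<omega>])
  show ?thesis by (simp add: quenched_law_def)
qed

lemma emeasure_quenched_law_emb: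
  assumes \<omega>: "\<omega> \<in> space env_space" and A: "A \<in> sets (\<Pi>\<^sub>M i\<in>{0..<n}. count_space UNIV)"
  shows "emeasure (quenched_law \<omega> x) (prod_emb UNIV (\<lambda>_. count_space UNIV) {0..<n} A) =
    emeasure (Ionescu_Tulcea.C (walk_kernel \<omega> x) (\<lambda>_. count_space UNIV) 0 n (\<lambda>_. undefined)) A"
proof -
  interpret IT: Ionescu_Tulcea "walk_kernel \<omega> x" "\<lambda>_. count_space UNIV"
    by (rule Ionescu_Tulcea_walk[OF \<omega>])
  have "prod_emb {0..<n} (\<lambda>_. count_space UNIV) {0..<n} A = A"
    using sets.sets_into_space[OF A] by (intro prod_emb_id) (simp add: space_PiM)
  then show ?thesis
    using IT.lim[OF _ A] IT.emeasure_CI[OF order_refl A] by (simp add: quenched_law_def)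
qed

lemma prob_space_quenched_law:
  assumes \<omega>: "\<omega> \<in> space env_space"
  shows "prob_space (quenched_law \<omega> x)"
proof
  interpret IT: Ionescu_Tulcea "walk_kernel \<omega> x" "\<lambda>_. count_space UNIV"
    by (rule Ionescu_Tulcea_walk[OF \<omega>])
  let ?A = "space (\<Pi>\<^sub>M i\<in>{0..<0}. count_space (UNIV :: site set))"
  have "space (quenched_law \<omega> x) = UNIV"
    by (simp add: quenched_law_def space_PiM)
  also have "\<dots> = prod_emb UNIV (\<lambda>_. count_space UNIV) {0..<0} ?A"
    by (auto simp: prod_emb_def space_PiM)
  finally show "emeasure (quenched_law \<omega> x) (space (quenched_law \<omega> x)) = 1"
    using emeasure_quenched_law_emb[OF \<omega> sets.top, of x 0]
    by (simp add: space_PiM PiM_empty)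
qed

lemma walk_cylinder_eq_emb:
  "{X :: nat \<Rightarrow> site. \<forall>i\<le>n. X i = f i} =
    prod_emb UNIV (\<lambda>_. count_space UNIV) {0..<Suc n} {restrict f {0..<Suc n}}"
  by (simp add: prod_emb_def restrict_def less_Suc_eq_le fun_eq_iff set_eq_iff)

lemma singleton_in_finite_PiM:
  "{restrict f {0..<n::nat}} \<in> sets (\<Pi>\<^sub>M i\<in>{0..<n}. count_space (UNIV :: site set))"
proof -
  have "{restrict f {0..<n}} = (\<Pi>\<^sub>E i\<in>{0..<n}. {f i})"
    by (auto simp: PiE_iff fun_eq_iff extensional_def restrict_def) 
  also have "\<dots> \<in> sets (\<Pi>\<^sub>M i\<in>{0..<n}. count_space (UNIV :: site set))"
    by (rule sets_PiM_I_finite) auto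
  finally show ?thesis .
qed

text \<open>The Markov property: \<open>quenched_law \<omega> x\<close> has the cylinder probabilities of the Markov chain
  started at \<open>x\<close>.\<close>
lemma emeasure_quenched_law_cylinder:
  assumes \<omega>: "\<omega> \<in> space env_space"
  shows "emeasure (quenched_law \<omega> x) {X. \<forall>i\<le>n. X i = f i} =
    (if f 0 = x then \<Prod>i<n. emeasure (jump \<omega> (f i)) {f (Suc i)} else 0)"
proof -
  interpret IT: Ionescu_Tulcea "walk_kernel \<omega> x" "\<lambda>_. count_space UNIV"
    by (rule Ionescu_Tulcea_walk[OF \<omega>])
  let ?C = "\<lambda>n. IT.C 0 n (\<lambda>_. undefined)"
  note [simp] = singleton_in_finite_PiM
  have u: "(\<lambda>_. undefined) \<in> space (\<Pi>\<^sub>M i\<in>{0..<0}. count_space (UNIV :: site set))"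
    by (auto simp: space_PiM)
  have step: "emeasure (?C (Suc n)) {restrict f {0..<Suc n}} =
      emeasure (walk_kernel \<omega> x n (restrict f {0..<n})) {f n} * emeasure (?C n) {restrict f {0..<n}}" for n
  proof -
    have sC: "sets (?C n) = sets (\<Pi>\<^sub>M i\<in>{0..<n}. count_space UNIV)"
      using IT.sets_C[OF u, of n] by simp
    have "emeasure (?C (Suc n)) {restrict f {0..<Suc n}} =
        (\<integral>\<^sup>+w. emeasure (IT.eP n w) {restrict f {0..<Suc n}} \<partial>?C n)"
      using IT.measurable_eP[of n] sC
      by (simp, subst emeasure_bind[where N="\<Pi>\<^sub>M i\<in>{0..<Suc n}. count_space UNIV"])
         (auto simp: measurable_cong_sets[OF sC refl] sets_eq_imp_space_eq[OF sC] space_PiM PiE_eq_empty_iff)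
    also have "\<dots> = (\<integral>\<^sup>+w. emeasure (walk_kernel \<omega> x n (restrict f {0..<n})) {f n} *
        indicator {restrict f {0..<n}} w \<partial>?C n)"
    proof (rule nn_integral_cong)
      fix w assume "w \<in> space (?C n)"
      then have w: "w \<in> space (\<Pi>\<^sub>M i\<in>{0..<n}. count_space UNIV)"
        using sets_eq_imp_space_eq[OF sC] by simp
      then have we: "w \<in> extensional {0..<n}" by (simp add: space_PiM PiE_def)
      have "(\<lambda>v. fun_upd w n v) -` {restrict f {0..<Suc n}} \<inter> UNIV =
          (if w = restrict f {0..<n} then {f n} else {})"
      proof -
        have "fun_upd w n v = restrict f {0..<Suc n} \<longleftrightarrow> w = restrict f {0..<n} \<and> v = f n" for v
          using we unfolding fun_eq_iff extensional_def restrict_def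
          by (simp add: less_Suc_eq) (metis less_irrefl)
        then show ?thesis by auto
      qed
      then show "emeasure (IT.eP n w) {restrict f {0..<Suc n}} =
        emeasure (walk_kernel \<omega> x n (restrict f {0..<n})) {f n} * indicator {restrict f {0..<n}} w"
        using IT.emeasure_eP[OF w, of "{restrict f {0..<Suc n}}"] by (auto simp: indicator_def)
    qed
    also have "\<dots> = emeasure (walk_kernel \<omega> x n (restrict f {0..<n})) {f n} * emeasure (?C n) {restrict f {0..<n}}"
      by (rule nn_integral_cmult_indicator) (simp add: sC)
    finally show ?thesis .
  qed
  have "emeasure (?C (Suc n)) {restrict f {0..<Suc n}} =
    (if f 0 = x then \<Prod>i<n. emeasure (jump \<omega> (f i)) {f (Suc i)} else 0)"
  proof (induction n)
    case 0
    have "restrict f {0..<0} = (\<lambda>_. undefined)" by auto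
    moreover have "emeasure (?C 0) {\<lambda>_. undefined} = 1"
      by (simp add: PiM_empty)
    ultimately show ?case
      using step[of 0] by (auto simp: indicator_def simp del: IT.C.simps restrict_apply atLeast0_lessThan_Suc)
  next
    case (Suc n)
    show ?case
      unfolding step[of "Suc n"] Suc by (simp add: mult.commute)
  qed
  then show ?thesis
    unfolding walk_cylinder_eq_emb
    by (subst emeasure_quenched_law_emb[OF \<omega>]) (simp_all del: IT.C.simps)
qed

lemma measurable_walk_prefix:
  "(\<lambda>\<omega>. Ionescu_Tulcea.C (walk_kernel \<omega> x) (\<lambda>_. count_space UNIV) 0 n (\<lambda>_. undefined)) \<in>
    env_space \<rightarrow>\<^sub>M subprob_algebra (\<Pi>\<^sub>M i\<in>{0..<n}. count_space UNIV)"
proof (induction n)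
  case 0
  have "(\<lambda>\<omega>. return (\<Pi>\<^sub>M i\<in>{0..<0}. count_space (UNIV :: site set)) (\<lambda>_. undefined)) \<in>
      env_space \<rightarrow>\<^sub>M subprob_algebra (\<Pi>\<^sub>M i\<in>{0..<0}. count_space UNIV)"
    by (intro measurable_const) (auto simp: space_subprob_algebra space_PiM
      intro!: prob_space_imp_subprob_space prob_space_return)
  then show ?case
    by (rule measurable_cong[THEN iffD1, rotated])
       (simp add: Ionescu_Tulcea.C.simps[OF Ionescu_Tulcea_walk])
next
  case (Suc n)
  let ?P = "\<lambda>n. \<Pi>\<^sub>M i\<in>{0..<n}. count_space (UNIV :: site set)"
  let ?C = "\<lambda>\<omega> n. Ionescu_Tulcea.C (walk_kernel \<omega> x) (\<lambda>_. count_space UNIV) 0 n (\<lambda>_. undefined)"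
  let ?E = "\<lambda>\<omega> w. distr (walk_kernel \<omega> x n w) (?P (Suc n)) (fun_upd w n)"
  have "(\<lambda>(p, v). fun_upd (snd p) n v) \<in> (env_space \<Otimes>\<^sub>M ?P n) \<Otimes>\<^sub>M count_space UNIV \<rightarrow>\<^sub>M ?P (Suc n)"
    unfolding case_prod_beta
    by (rule measurable_fun_upd[where J="{0..<n}"]) auto
  then have "(\<lambda>p. ?E (fst p) (snd p)) \<in> env_space \<Otimes>\<^sub>M ?P n \<rightarrow>\<^sub>M subprob_algebra (?P (Suc n))"
    using measurable_walk_kernel[of x n] unfolding case_prod_beta
    by (intro measurable_distr2[where M="count_space UNIV"]) (auto simp: case_prod_beta)
  then have "(\<lambda>\<omega>. ?C \<omega> n \<bind> ?E \<omega>) \<in> env_space \<rightarrow>\<^sub>M subprob_algebra (?P (Suc n))"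
    by (rule measurable_bind[OF Suc.IH])
  then show ?case
  proof (rule measurable_cong[THEN iffD1, rotated])
    fix \<omega> assume \<omega>: "\<omega> \<in> space env_space"
    interpret IT: Ionescu_Tulcea "walk_kernel \<omega> x" "\<lambda>_. count_space UNIV"
      by (rule Ionescu_Tulcea_walk[OF \<omega>])
    show "?C \<omega> n \<bind> ?E \<omega> = ?C \<omega> (Suc n)"
      by (simp add: IT.eP_def[abs_def])
  qed
qed

lemma measurable_quenched_law: "(\<lambda>\<omega>. quenched_law \<omega> x) \<in> env_space \<rightarrow>\<^sub>M prob_algebra path_space"
proof (rule measurable_prob_algebra_generated[OF sets_PiM Int_stable_prod_algebra prod_algebra_sets_into_space])
  fix A assume "A \<in> prod_algebra UNIV (\<lambda>_::nat. count_space (UNIV :: site set))"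
  then obtain J E where A: "A = prod_emb UNIV (\<lambda>_. count_space UNIV) J (\<Pi>\<^sub>E j\<in>J. E j)" "finite J"
    by (rule prod_algebraE)
  define n where "n = Suc (Max (insert 0 J))"
  have J: "J \<subseteq> {0..<n}"
    using A(2) by (auto simp: n_def less_Suc_eq_le)
  define B where "B = prod_emb {0..<n} (\<lambda>_. count_space (UNIV :: site set)) J (\<Pi>\<^sub>E j\<in>J. E j)"
  have B: "B \<in> sets (\<Pi>\<^sub>M i\<in>{0..<n}. count_space UNIV)"
    unfolding B_def using J A(2) by (intro sets_PiM_I) auto
  have AB: "A = prod_emb UNIV (\<lambda>_. count_space UNIV) {0..<n} B"
    unfolding A(1) B_def using J by (subst prod_emb_trans) auto
  have "(\<lambda>\<omega>. emeasure (Ionescu_Tulcea.C (walk_kernel \<omega> x) (\<lambda>_. count_space UNIV) 0 n (\<lambda>_. undefined)) B)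
      \<in> borel_measurable env_space"
    by (rule measurable_emeasure_kernel[OF measurable_walk_prefix B])
  then show "(\<lambda>\<omega>. emeasure (quenched_law \<omega> x) A) \<in> borel_measurable env_space"
    by (rule measurable_cong[THEN iffD1, rotated]) (simp add: AB emeasure_quenched_law_emb[OF _ B])
qed (simp_all add: prob_space_quenched_law sets_quenched_law)

definition averaged_law :: "env measure \<Rightarrow> site \<Rightarrow> (nat \<Rightarrow> site) measure" where
  "averaged_law P x = P \<bind> (\<lambda>\<omega>. quenched_law \<omega> x)"

lemma
  assumes P: "prob_space P" "sets P = sets env_space"
  shows sets_averaged_law: "sets (averaged_law P x) = sets path_space"
    and prob_space_averaged_law: "prob_space (averaged_law P x)"
    and emeasure_averaged_law: "A \<in> sets path_space \<Longrightarrow>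
      emeasure (averaged_law P x) A = (\<integral>\<^sup>+\<omega>. emeasure (quenched_law \<omega> x) A \<partial>P)"
proof -
  have Q: "(\<lambda>\<omega>. quenched_law \<omega> x) \<in> P \<rightarrow>\<^sub>M prob_algebra path_space"
    using measurable_quenched_law[of x] by (simp add: measurable_cong_sets[OF P(2) refl])
  note Q' = measurable_prob_algebraD[OF Q]
  have ne: "space P \<noteq> {}" using P(1) by (rule prob_space.not_empty)
  show "sets (averaged_law P x) = sets path_space"
    unfolding averaged_law_def by (rule sets_bind[OF sets_kernel[OF Q'] ne])
  show "prob_space (averaged_law P x)"
    unfolding averaged_law_def using Q
    by (intro prob_space.prob_space_bind[OF P(1) _ Q'] AE_I2)
       (auto dest!: measurable_space simp: space_prob_algebra)
  show "A \<in> sets path_space \<Longrightarrow>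
      emeasure (averaged_law P x) A = (\<integral>\<^sup>+\<omega>. emeasure (quenched_law \<omega> x) A \<partial>P)"
    unfolding averaged_law_def by (rule emeasure_bind[OF ne Q'])
qed

definition real_site :: "site \<Rightarrow> real \<times> real" where
  "real_site x = (of_int (fst x), of_int (snd x))"

definition empirical_velocity :: "nat \<Rightarrow> (nat \<Rightarrow> site) \<Rightarrow> real \<times> real" where
  "empirical_velocity n X = (1 / real n) *\<^sub>R real_site (X n)"

lemma measurable_empirical_velocity [measurable]: "empirical_velocity n \<in> borel_measurable path_space"
  unfolding empirical_velocity_def
  by (rule measurable_compose[OF measurable_component_singleton]) auto

text \<open>The velocity is given by its closed form, the mean step \<open>\<Sum>z. z * E[\<pi>(0, z)]\<close>.\<close>
definition lln_velocity :: "env measure \<Rightarrow> real \<times> real" where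
  "lln_velocity P = (\<Sum>z\<in>steps. (\<integral>\<omega>. \<omega> 0 z \<partial>P) *\<^sub>R real_site z)"

definition ln_ereal :: "real \<Rightarrow> ereal" where
  "ln_ereal p = (if p = 0 then -\<infinity> else ereal (ln p))"

text \<open>The term \<open>n = 0\<close> equals 0 and does not affect the limits.\<close>
definition satisfies_LDP :: "(nat \<Rightarrow> ('a::topological_space) measure) \<Rightarrow> ('a \<Rightarrow> ereal) \<Rightarrow> bool" where
  "satisfies_LDP Q I \<longleftrightarrow>
     (\<forall>G\<in>sets borel.
        - (INF x\<in>interior G. I x) \<le> liminf (\<lambda>n. ereal (1 / real n) * ln_ereal (measure (Q n) G)) \<and>
        limsup (\<lambda>n. ereal (1 / real n) * ln_ereal (measure (Q n) G)) \<le> - (INF x\<in>closure G. I x))"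

text \<open>Lower semicontinuity is expressed by closed sublevel sets. In the convexity inequality
  the convention \<open>0 * \<infinity> = 0\<close> makes the endpoints \<open>t \<in> {0, 1}\<close> trivial.\<close>
definition convex_rate_function :: "(('a::real_normed_vector) \<Rightarrow> ereal) \<Rightarrow> bool" where
  "convex_rate_function I \<longleftrightarrow>
     (\<forall>x. 0 \<le> I x) \<and>
     (\<forall>c. closed {x. I x \<le> c}) \<and>
     (\<forall>x y. \<forall>t\<in>{0..1}. I ((1 - t) *\<^sub>R x + t *\<^sub>R y) \<le> ereal (1 - t) * I x + ereal t * I y)"

definition quenched_rate_function :: "env measure \<Rightarrow> (real \<times> real \<Rightarrow> ereal) \<Rightarrow> bool" where
  "quenched_rate_function P I \<longleftrightarrow> convex_rate_function I \<and>
     (AE \<omega> in P. satisfies_LDP (\<lambda>n. distr (quenched_law \<omega> 0) borel (empirical_velocity n)) I)"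

definition averaged_rate_function :: "env measure \<Rightarrow> (real \<times> real \<Rightarrow> ereal) \<Rightarrow> bool" where
  "averaged_rate_function P I \<longleftrightarrow> convex_rate_function I \<and>
     satisfies_LDP (\<lambda>n. distr (averaged_law P 0) borel (empirical_velocity n)) I"

end

theory Submission
  imports Defs "HOL-Real_Asymp.Real_Asymp"
begin

text \<open>Every site is visited at most once, so the averaged walk is a homogeneous random walk and \<open>I\<^sub>a\<close> is
  its Cramer rate function. Tilting by \<open>exp (\<theta> * S)\<close> turns the quenched walk into a directed polymer in
  dimension 1 + 1 whose site weights have mean 1 and, if \<open>\<theta> \<noteq> 0\<close>, positive variance. The claim
  \<open>I\<^sub>a < I\<^sub>q\<close> away from \<open>\<xi>\<^sub>o\<close> says that this polymer has negative free energy. By subadditivity of the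
  square root it suffices to find one length \<open>m\<close> for which the expected square roots of the
  point-to-point partition functions sum to less than 1. A change of the environment in a tube
  slightly wider than diffusive makes the expected square root of the whole partition function smaller than
  any power of \<open>m\<close>, whereas there are only \<open>2 * m + 1\<close> endpoints. At the velocities \<open>\<plusminus>1\<close>
  the length \<open>m = 1\<close> and a large \<open>\<theta>\<close> suffice.\<close>

subsection \<open>Path sums\<close>

primrec pass :: "(site \<Rightarrow> site \<Rightarrow> real) \<Rightarrow> site \<Rightarrow> nat \<Rightarrow> site \<Rightarrow> real" where
  "pass K x 0 y = (if y = x then 1 else 0)"
| "pass K x (Suc n) y = (\<Sum>z\<in>steps. pass K x n (y - z) * K (y - z) z)"

definition reach :: "site \<Rightarrow> nat \<Rightarrow> site set" where
  "reach x n = (\<lambda>i. (fst x + i, snd x + int n)) ` {- int n..int n}"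

lemma finite_reach [simp]: "finite (reach x n)"
  by (simp add: reach_def)

lemma mem_reach: "y \<in> reach x n \<longleftrightarrow> \<bar>fst y - fst x\<bar> \<le> int n \<and> snd y = snd x + int n"
  by (cases y) (auto simp: reach_def image_iff intro!: bexI[of _ "fst y - fst x"])

lemma card_reach: "card (reach x n) = 2 * n + 1"
  by (simp add: reach_def card_image inj_on_def)

lemma reach_0 [simp]: "reach x 0 = {x}"
  by (simp add: reach_def)

lemma reach_Suc: "y \<in> reach x n \<Longrightarrow> z \<in> steps \<Longrightarrow> y + z \<in> reach x (Suc n)"
  by (auto simp: mem_reach steps_def)

lemma sum_steps: "(\<Sum>z\<in>steps. f z) = f (1, 1) + f (-1, 1)"
  by (simp add: steps_def)

lemma pass_eq_0: "y \<notin> reach x n \<Longrightarrow> pass K x n y = 0"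
proof (induction n arbitrary: y)
  case (Suc n)
  have "pass K x n (y - z) = 0" if "z \<in> steps" for z
    using reach_Suc[of "y - z" x n z] that Suc.prems by (intro Suc.IH) (auto simp del: split_paired_All)
  then show ?case by simp
qed auto

lemma pass_nonneg:
  assumes "\<And>u z. z \<in> steps \<Longrightarrow> 0 \<le> K u z"
  shows "0 \<le> pass K x n y"
  by (induction n arbitrary: y) (auto intro!: sum_nonneg mult_nonneg_nonneg assms)

lemma sum_pass_Suc:
  "(\<Sum>y\<in>reach x (Suc n). pass K x (Suc n) y * F y) =
   (\<Sum>y\<in>reach x n. pass K x n y * (\<Sum>z\<in>steps. K y z * F (y + z)))"
proof -
  have "(\<Sum>y\<in>reach x (Suc n). pass K x n (y - z) * K (y - z) z * F y) =
        (\<Sum>y\<in>reach x n. pass K x n y * K y z * F (y + z))" if "z \<in> steps" for z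
  proof -
    have "(\<Sum>y\<in>reach x n. pass K x n y * K y z * F (y + z)) =
        (\<Sum>y\<in>(\<lambda>y. y + z) ` reach x n. pass K x n (y - z) * K (y - z) z * F y)"
      by (subst sum.reindex) (auto simp: inj_on_def)
    also have "\<dots> = (\<Sum>y\<in>reach x (Suc n). pass K x n (y - z) * K (y - z) z * F y)"
    proof (rule sum.mono_neutral_left)
      show "\<forall>i\<in>reach x (Suc n) - (\<lambda>y. y + z) ` reach x n. pass K x n (i - z) * K (i - z) z * F i = 0"
      proof
        fix i assume i: "i \<in> reach x (Suc n) - (\<lambda>y. y + z) ` reach x n"
        then have "i - z \<notin> reach x n"
          by (metis DiffD2 diff_add_cancel image_eqI)
        then show "pass K x n (i - z) * K (i - z) z * F i = 0" by (simp add: pass_eq_0)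
      qed
      show "(\<lambda>y. y + z) ` reach x n \<subseteq> reach x (Suc n)"
        using reach_Suc[OF _ that] by blast
    qed simp
    finally show ?thesis by simp
  qed
  note shift = this
  have "(\<Sum>y\<in>reach x (Suc n). pass K x (Suc n) y * F y) =
      (\<Sum>z\<in>steps. \<Sum>y\<in>reach x (Suc n). pass K x n (y - z) * K (y - z) z * F y)"
    by (subst sum.swap) (simp add: sum_distrib_right)
  also have "\<dots> = (\<Sum>z\<in>steps. \<Sum>y\<in>reach x n. pass K x n y * K y z * F (y + z))"
    by (intro sum.cong shift refl)
  also have "\<dots> = (\<Sum>y\<in>reach x n. pass K x n y * (\<Sum>z\<in>steps. K y z * F (y + z)))"
    by (subst sum.swap) (simp add: sum_distrib_left mult.assoc)
  finally show ?thesis .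
qed

lemma pass_cong: "(\<And>u z. z \<in> steps \<Longrightarrow> K u z = K' u z) \<Longrightarrow> pass K x n y = pass K' x n y"
  by (induction n arbitrary: y) auto

lemma pass_add:
  "pass K x (k + m) y = (\<Sum>u\<in>reach x k. pass K x k u * pass K u m y)"
proof (induction m arbitrary: y)
  case 0
  have "(\<Sum>u\<in>reach x k. pass K x k u * pass K u 0 y) = (\<Sum>u\<in>reach x k. if u = y then pass K x k u else 0)"
    by (intro sum.cong) auto
  then show ?case by (simp add: pass_eq_0)
next
  case (Suc m)
  have "pass K x (k + Suc m) y =
      (\<Sum>z\<in>steps. \<Sum>u\<in>reach x k. pass K x k u * (pass K u m (y - z) * K (y - z) z))"
    by (simp add: Suc sum_distrib_right mult.assoc)
  also have "\<dots> = (\<Sum>u\<in>reach x k. pass K x k u * pass K u (Suc m) y)"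
    by (subst sum.swap) (simp add: sum_distrib_left)
  finally show ?case .
qed

lemma pass_tilt:
  "pass (\<lambda>u z. s * exp (\<theta> * of_int (fst z)) * K u z) x n y =
     s ^ n * exp (\<theta> * of_int (fst y - fst x)) * pass K x n y"
proof (induction n arbitrary: y)
  case (Suc n)
  have "exp (\<theta> * of_int (fst y - fst x)) = exp (\<theta> * of_int (fst (y - z) - fst x)) * exp (\<theta> * of_int (fst z))" for z
    by (simp add: exp_add[symmetric] algebra_simps)
  then show ?case
    unfolding pass.simps Suc sum_distrib_left by (intro sum.cong) (simp_all add: mult_ac)
qed auto

lemma sum_pass_const:
  assumes "\<And>u. (\<Sum>z\<in>steps. K u z) = 1"
  shows "(\<Sum>y\<in>reach x n. pass K x n y) = 1"
proof (induction n)
  case (Suc n)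
  then show ?case
    using sum_pass_Suc[where F = "\<lambda>_. 1" and K = K and x = x and n = n] assms by simp
qed simp

subsection \<open>Local functions of the environment\<close>

definition local_fun :: "site set \<Rightarrow> (env \<Rightarrow> real) \<Rightarrow> bool" where
  "local_fun A F \<longleftrightarrow> F \<in> borel_measurable env_space \<and>
     (\<exists>C. \<forall>\<omega>\<in>space env_space. \<bar>F \<omega>\<bar> \<le> C) \<and>
     (\<forall>\<omega>\<in>space env_space. \<forall>\<omega>'\<in>space env_space. (\<forall>x\<in>A. \<omega> x = \<omega>' x) \<longrightarrow> F \<omega> = F \<omega>')"

lemma local_funI:
  assumes "F \<in> borel_measurable env_space" "\<And>\<omega>. \<omega> \<in> space env_space \<Longrightarrow> \<bar>F \<omega>\<bar> \<le> C"
    and "\<And>\<omega> \<omega>'. \<omega> \<in> space env_space \<Longrightarrow> \<omega>' \<in> space env_space \<Longrightarrow> \<forall>x\<in>A. \<omega> x = \<omega>' x \<Longrightarrow> F \<omega> = F \<omega>'"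
  shows "local_fun A F"
  using assms unfolding local_fun_def by blast

lemma local_fun_mono: "local_fun A F \<Longrightarrow> A \<subseteq> B \<Longrightarrow> local_fun B F"
  unfolding local_fun_def by (meson subsetD)

lemma local_fun_const [simp]: "local_fun A (\<lambda>_. c)"
  by (auto simp: local_fun_def)

lemma local_fun_measurable: "local_fun A F \<Longrightarrow> F \<in> borel_measurable env_space"
  by (simp add: local_fun_def)

lemma local_fun_add:
  assumes F: "local_fun A F" and G: "local_fun A G"
  shows "local_fun A (\<lambda>\<omega>. F \<omega> + G \<omega>)"
proof -
  obtain C D where C: "\<And>\<omega>. \<omega> \<in> space env_space \<Longrightarrow> \<bar>F \<omega>\<bar> \<le> C"
    and D: "\<And>\<omega>. \<omega> \<in> space env_space \<Longrightarrow> \<bar>G \<omega>\<bar> \<le> D"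
    using F G unfolding local_fun_def by blast
  show ?thesis
  proof (rule local_funI[where C = "C + D"])
    show "\<bar>F \<omega> + G \<omega>\<bar> \<le> C + D" if "\<omega> \<in> space env_space" for \<omega>
      using C[OF that] D[OF that] by linarith
    show "F \<omega> + G \<omega> = F \<omega>' + G \<omega>'"
      if "\<omega> \<in> space env_space" "\<omega>' \<in> space env_space" "\<forall>x\<in>A. \<omega> x = \<omega>' x" for \<omega> \<omega>'
      using F G that unfolding local_fun_def by metis
  qed (intro borel_measurable_add borel_measurable_times local_fun_measurable[OF F] local_fun_measurable[OF G])
qed

lemma local_fun_mult:
  assumes F: "local_fun A F" and G: "local_fun A G"
  shows "local_fun A (\<lambda>\<omega>. F \<omega> * G \<omega>)"
proof -
  obtain C D where C: "\<And>\<omega>. \<omega> \<in> space env_space \<Longrightarrow> \<bar>F \<omega>\<bar> \<le> C"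
    and D: "\<And>\<omega>. \<omega> \<in> space env_space \<Longrightarrow> \<bar>G \<omega>\<bar> \<le> D"
    using F G unfolding local_fun_def by blast
  show ?thesis
  proof (rule local_funI[where C = "C * D"])
    show "\<bar>F \<omega> * G \<omega>\<bar> \<le> C * D" if "\<omega> \<in> space env_space" for \<omega>
      using C[OF that] D[OF that] by (simp add: abs_mult mult_mono')
    show "F \<omega> * G \<omega> = F \<omega>' * G \<omega>'"
      if "\<omega> \<in> space env_space" "\<omega>' \<in> space env_space" "\<forall>x\<in>A. \<omega> x = \<omega>' x" for \<omega> \<omega>'
      using F G that unfolding local_fun_def by metis
  qed (intro borel_measurable_add borel_measurable_times local_fun_measurable[OF F] local_fun_measurable[OF G])
qed

lemma local_fun_sum:
  "finite S \<Longrightarrow> (\<And>i. i \<in> S \<Longrightarrow> local_fun A (F i)) \<Longrightarrow> local_fun A (\<lambda>\<omega>. \<Sum>i\<in>S. F i \<omega>)"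
  by (induction S rule: finite_induct) (auto intro!: local_fun_add)

lemma local_fun_prod:
  "finite S \<Longrightarrow> (\<And>i. i \<in> S \<Longrightarrow> local_fun A (F i)) \<Longrightarrow> local_fun A (\<lambda>\<omega>. \<Prod>i\<in>S. F i \<omega>)"
  by (induction S rule: finite_induct) (auto intro!: local_fun_mult)

lemma local_fun_sqrt:
  assumes F: "local_fun A F"
  shows "local_fun A (\<lambda>\<omega>. sqrt (F \<omega>))"
proof -
  obtain C where C: "\<And>\<omega>. \<omega> \<in> space env_space \<Longrightarrow> \<bar>F \<omega>\<bar> \<le> C"
    using F unfolding local_fun_def by blast
  show ?thesis
  proof (rule local_funI[where C = "sqrt C"])
    show "\<bar>sqrt (F \<omega>)\<bar> \<le> sqrt C" if "\<omega> \<in> space env_space" for \<omega>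
    proof -
      have "\<bar>sqrt (F \<omega>)\<bar> = sqrt \<bar>F \<omega>\<bar>"
        by (cases "0 \<le> F \<omega>") (simp_all add: real_sqrt_minus[symmetric] abs_of_neg)
      then show ?thesis using C[OF that] by simp
    qed
    show "sqrt (F \<omega>) = sqrt (F \<omega>')"
      if "\<omega> \<in> space env_space" "\<omega>' \<in> space env_space" "\<forall>x\<in>A. \<omega> x = \<omega>' x" for \<omega> \<omega>'
      using F that unfolding local_fun_def by metis
  qed (use local_fun_measurable[OF F] in measurable)
qed

lemma local_fun_inverse:
  assumes F: "local_fun A F" and a: "0 < a" "\<And>\<omega>. \<omega> \<in> space env_space \<Longrightarrow> a \<le> F \<omega>"
  shows "local_fun A (\<lambda>\<omega>. 1 / F \<omega>)"
proof (rule local_funI[where C = "1 / a"])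
  show "\<bar>1 / F \<omega>\<bar> \<le> 1 / a" if "\<omega> \<in> space env_space" for \<omega>
    using a(1) a(2)[OF that] by (simp add: frac_le)
  show "1 / F \<omega> = 1 / F \<omega>'"
    if "\<omega> \<in> space env_space" "\<omega>' \<in> space env_space" "\<forall>x\<in>A. \<omega> x = \<omega>' x" for \<omega> \<omega>'
    using F that unfolding local_fun_def by metis
qed (use local_fun_measurable[OF F] in measurable)

lemma env_nonneg: "\<omega> \<in> space env_space \<Longrightarrow> z \<in> steps \<Longrightarrow> 0 \<le> \<omega> x z"
  using env_space_prob_vector[of \<omega> x] by (simp add: prob_vectors_def)

lemma env_sum: "\<omega> \<in> space env_space \<Longrightarrow> (\<Sum>z\<in>steps. \<omega> x z) = 1"
  using env_space_prob_vector[of \<omega> x] by (simp add: prob_vectors_def)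

lemma env_le_1: "\<omega> \<in> space env_space \<Longrightarrow> z \<in> steps \<Longrightarrow> \<omega> x z \<le> 1"
  using env_sum[of \<omega> x] env_nonneg[of \<omega> "(1, 1)" x] env_nonneg[of \<omega> "(-1, 1)" x]
  by (auto simp: steps_def)

lemma local_fun_env: "z \<in> steps \<Longrightarrow> x \<in> A \<Longrightarrow> local_fun A (\<lambda>\<omega>. \<omega> x z)"
  by (rule local_funI[where C = 1]) (auto simp: measurable_env_apply env_nonneg env_le_1)

definition slab :: "int \<Rightarrow> int \<Rightarrow> site set" where
  "slab a b = {x. a \<le> snd x \<and> snd x < b}"

lemma local_fun_pass:
  "local_fun (slab (snd x) (snd x + int n)) (\<lambda>\<omega>. pass (\<lambda>u z. c z * \<omega> u z) x n y)"
proof (induction n arbitrary: y)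
  case (Suc n)
  let ?S = "slab (snd x) (snd x + int (Suc n))"
  have "local_fun ?S (\<lambda>\<omega>. pass (\<lambda>u z. c z * \<omega> u z) x n (y - z) * (c z * \<omega> (y - z) z))"
    if z: "z \<in> steps" for z
  proof (cases "y - z \<in> reach x n")
    case True
    then have "y - z \<in> ?S" by (simp add: mem_reach slab_def)
    then show ?thesis
      using z by (intro local_fun_mult local_fun_mono[OF Suc] local_fun_const local_fun_env) (auto simp: slab_def)
  qed (simp add: pass_eq_0)
  then show ?case
    unfolding pass.simps by (intro local_fun_sum) auto
qed simp

locale iid_env =
  fixes P :: "env measure"
  assumes iid: "iid_environment P"
begin

lemma prob_space_P: "prob_space P" and sets_P: "sets P = sets env_space"
  using iid by (auto simp: iid_environment_def)

sublocale prob_space P by (rule prob_space_P)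

lemma space_P: "space P = space env_space"
  by (rule sets_eq_imp_space_eq[OF sets_P])

lemma measurable_P: "measurable P N = measurable env_space N"
  by (rule measurable_cong_sets[OF sets_P refl])

lemma local_fun_integrable:
  assumes "local_fun A F" shows "integrable P F"
proof -
  obtain C where C: "\<And>\<omega>. \<omega> \<in> space env_space \<Longrightarrow> \<bar>F \<omega>\<bar> \<le> C"
    using assms unfolding local_fun_def by blast
  show ?thesis
    by (rule integrable_const_bound[where B = C]) (use local_fun_measurable[OF assms] C in \<open>auto simp: space_P measurable_P\<close>)
qed

lemma expectation_mult:
  assumes F: "local_fun A F" and G: "local_fun B G" and AB: "A \<inter> B = {}"
  shows "expectation (\<lambda>\<omega>. F \<omega> * G \<omega>) = expectation F * expectation G"
proof -
  obtain \<omega>0 where \<omega>0: "\<omega>0 \<in> space env_space"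
    using not_empty space_P by auto
  let ?r = "\<lambda>A (\<omega> :: env). restrict \<omega> A"
  define e where "e A \<eta> x = (if x \<in> A then \<eta> x else \<omega>0 x)" for A :: "site set" and \<eta> :: env and x
  have e_meas: "e A \<in> (\<Pi>\<^sub>M x\<in>A. prob_vector_space) \<rightarrow>\<^sub>M env_space" for A
    unfolding env_space_def
  proof (rule measurable_PiM_single')
    show "(\<lambda>\<eta>. e A \<eta> x) \<in> (\<Pi>\<^sub>M x\<in>A. prob_vector_space) \<rightarrow>\<^sub>M prob_vector_space" for x
      using \<omega>0 by (cases "x \<in> A")
        (auto simp: e_def env_space_def space_PiM PiE_iff intro!: measurable_const measurable_component_singleton
           simp del: split_paired_All)
    show "e A \<in> space (\<Pi>\<^sub>M x\<in>A. prob_vector_space) \<rightarrow> UNIV \<rightarrow>\<^sub>E space prob_vector_space"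
      using \<omega>0 by (fastforce simp: e_def env_space_def space_PiM)
  qed
  have e_r: "F \<omega> = (F \<circ> e A) (?r A \<omega>)" if "local_fun A F" "\<omega> \<in> space P" for F \<omega> A
  proof -
    have "?r A \<omega> \<in> space (\<Pi>\<^sub>M x\<in>A. prob_vector_space)"
      using that by (auto simp: space_P env_space_def space_PiM)
    then have "e A (?r A \<omega>) \<in> space env_space"
      using measurable_space[OF e_meas] by blast
    moreover have "\<forall>x\<in>A. \<omega> x = e A (?r A \<omega>) x" by (simp add: e_def)
    ultimately show ?thesis using that unfolding local_fun_def space_P comp_def by blast
  qed
  have "indep_vars (\<lambda>_. prob_vector_space) (\<lambda>x \<omega>. \<omega> x) UNIV"
    using iid by (simp add: iid_environment_def)
  then have "indep_var (PiM A (\<lambda>_. prob_vector_space)) (\<lambda>\<omega>. restrict (\<lambda>x. \<omega> x) A)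
      (PiM B (\<lambda>_. prob_vector_space)) (\<lambda>\<omega>. restrict (\<lambda>x. \<omega> x) B)"
    by (rule indep_var_restrict[OF _ AB]) auto
  then have ind: "indep_var borel ((F \<circ> e A) \<circ> ?r A) borel ((G \<circ> e B) \<circ> ?r B)"
    using F G by (intro indep_var_compose) (auto intro!: measurable_comp[OF e_meas] local_fun_measurable)
  have F': "integrable P ((F \<circ> e A) \<circ> ?r A)"
    using local_fun_integrable[OF F]
    by (rule Bochner_Integration.integrable_cong[THEN iffD1, rotated 2]) (use e_r[OF F] in simp_all)
  have G': "integrable P ((G \<circ> e B) \<circ> ?r B)"
    using local_fun_integrable[OF G]
    by (rule Bochner_Integration.integrable_cong[THEN iffD1, rotated 2]) (use e_r[OF G] in simp_all)
  have "expectation (\<lambda>\<omega>. F \<omega> * G \<omega>) = expectation (\<lambda>\<omega>. ((F \<circ> e A) \<circ> ?r A) \<omega> * ((G \<circ> e B) \<circ> ?r B) \<omega>)"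
    using e_r[OF F] e_r[OF G] by (intro Bochner_Integration.integral_cong) auto
  also have "\<dots> = expectation ((F \<circ> e A) \<circ> ?r A) * expectation ((G \<circ> e B) \<circ> ?r B)"
    by (rule indep_var_lebesgue_integral[OF ind F' G'])
  also have "\<dots> = expectation F * expectation G"
    using e_r[OF F] e_r[OF G] by (intro arg_cong2[where f = "(*)"] Bochner_Integration.integral_cong) auto
  finally show ?thesis .
qed

lemma expectation_prod:
  assumes "finite S" "\<And>x. x \<in> S \<Longrightarrow> local_fun {x} (F x)"
  shows "expectation (\<lambda>\<omega>. \<Prod>x\<in>S. F x \<omega>) = (\<Prod>x\<in>S. expectation (F x))"
  using assms
proof (induction S rule: finite_induct)
  case (insert x S)
  have "local_fun S (\<lambda>\<omega>. \<Prod>x\<in>S. F x \<omega>)"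
    using insert by (intro local_fun_prod) (auto intro: local_fun_mono)
  moreover have "local_fun {x} (F x)" using insert by auto
  ultimately show ?case
    using insert expectation_mult[of "{x}" "F x" S "\<lambda>\<omega>. \<Prod>x\<in>S. F x \<omega>"] by simp
qed (simp add: prob_space)

lemma expectation_site:
  assumes "f \<in> borel_measurable prob_vector_space"
  shows "expectation (\<lambda>\<omega>. f (\<omega> x) :: real) = expectation (\<lambda>\<omega>. f (\<omega> 0))"
proof -
  have m: "(\<lambda>\<omega>. \<omega> x) \<in> P \<rightarrow>\<^sub>M prob_vector_space" for x
    unfolding measurable_P env_space_def by (rule measurable_component_singleton) simp
  have "distr P prob_vector_space (\<lambda>\<omega>. \<omega> x) = distr P prob_vector_space (\<lambda>\<omega>. \<omega> 0)"
    using iid unfolding iid_environment_def by blast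
  then show ?thesis
    using integral_distr[OF m[of x] assms] integral_distr[OF m[of 0] assms] by simp
qed

end

subsection \<open>The laws of the walk as path sums\<close>

lemma walk_event_sets [measurable]: "{X. X n \<in> S} \<in> sets path_space"
proof -
  have "(\<lambda>X. X n) \<in> path_space \<rightarrow>\<^sub>M count_space (UNIV :: site set)"
    by (rule measurable_component_singleton) simp
  from measurable_sets[OF this, of S] show ?thesis by (simp add: space_PiM vimage_def)
qed

lemma cylinder_sets: "{X :: nat \<Rightarrow> site. \<forall>i\<le>n. X i = f i} \<in> sets path_space"
proof -
  have "{X :: nat \<Rightarrow> site. \<forall>i\<le>n. X i = f i} = (\<Inter>i\<in>{..n}. {X. X i \<in> {f i}})" by auto
  also have "\<dots> \<in> sets path_space" by (intro sets.finite_INT walk_event_sets) auto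
  finally show ?thesis .
qed

lemma emeasure_quenched_transition:
  assumes \<omega>: "\<omega> \<in> space env_space"
  shows "emeasure (quenched_law \<omega> x) {X. X n = u \<and> X (Suc n) = y} =
    emeasure (quenched_law \<omega> x) {X. X n = u} * emeasure (jump \<omega> u) {y}"
proof -
  let ?Q = "quenched_law \<omega> x"
  let ?H = "{f \<in> {..n} \<rightarrow>\<^sub>E UNIV. f n = u} :: (nat \<Rightarrow> site) set"
  let ?cyl = "\<lambda>n f. {X :: nat \<Rightarrow> site. \<forall>i\<le>n. X i = f i}"
  have [simp]: "sets ?Q = sets path_space" by (rule sets_quenched_law[OF \<omega>])
  have cH: "countable ?H"
    by (rule countable_subset[of _ "{..n} \<rightarrow>\<^sub>E UNIV"]) (auto intro!: countable_PiE)
  have inj: "f = g" if "f \<in> ?H" "g \<in> ?H" "X \<in> ?cyl n f" "X \<in> ?cyl n g" for f g X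
  proof
    show "f i = g i" for i
      using that by (cases "i \<le> n") (simp_all add: PiE_iff extensional_def)
  qed
  then have disj: "disjoint_family_on (?cyl n) ?H"
    unfolding disjoint_family_on_def by blast
  have sub: "?cyl (Suc n) (f(Suc n := y)) \<subseteq> ?cyl n f" for f
    by (auto split: if_splits)
  have disj': "disjoint_family_on (\<lambda>f. ?cyl (Suc n) (f(Suc n := y))) ?H"
    using disj sub unfolding disjoint_family_on_def by blast
  have restr: "restrict X {..n} \<in> ?H \<and> X \<in> ?cyl n (restrict X {..n})" if "X n = u" for X
    using that by auto
  have un: "{X. X n = u} = (\<Union>f\<in>?H. ?cyl n f)"
  proof (intro equalityI subsetI)
    fix X assume "X \<in> {X. X n = u}"
    then show "X \<in> (\<Union>f\<in>?H. ?cyl n f)" using restr[of X] by blast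
  qed auto
  have un': "{X. X n = u \<and> X (Suc n) = y} = (\<Union>f\<in>?H. ?cyl (Suc n) (f(Suc n := y)))"
  proof (intro equalityI subsetI)
    fix X assume "X \<in> {X. X n = u \<and> X (Suc n) = y}"
    then have "restrict X {..n} \<in> ?H" "X \<in> ?cyl (Suc n) ((restrict X {..n})(Suc n := y))"
      by (auto simp: le_Suc_eq)
    then show "X \<in> (\<Union>f\<in>?H. ?cyl (Suc n) (f(Suc n := y)))" by blast
  next
    fix X assume "X \<in> (\<Union>f\<in>?H. ?cyl (Suc n) (f(Suc n := y)))"
    then obtain f where f: "f \<in> ?H" "X \<in> ?cyl (Suc n) (f(Suc n := y))" by blast
    then have "X n = f n" "X (Suc n) = y" by auto
    with f show "X \<in> {X. X n = u \<and> X (Suc n) = y}" by auto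
  qed
  have cyl: "emeasure ?Q (?cyl (Suc n) (f(Suc n := y))) = emeasure ?Q (?cyl n f) * emeasure (jump \<omega> u) {y}"
    if "f \<in> ?H" for f
  proof -
    have "(\<Prod>i<n. emeasure (jump \<omega> ((f(Suc n := y)) i)) {(f(Suc n := y)) (Suc i)}) =
        (\<Prod>i<n. emeasure (jump \<omega> (f i)) {f (Suc i)})"
      by (intro prod.cong) auto
    then show ?thesis
      using that unfolding emeasure_quenched_law_cylinder[OF \<omega>] by simp
  qed
  have "emeasure ?Q {X. X n = u \<and> X (Suc n) = y} =
      (\<integral>\<^sup>+f. emeasure ?Q (?cyl (Suc n) (f(Suc n := y))) \<partial>count_space ?H)"
    unfolding un' by (intro emeasure_UN_countable cH disj') (simp add: cylinder_sets)
  also have "\<dots> = (\<integral>\<^sup>+f. emeasure ?Q (?cyl n f) * emeasure (jump \<omega> u) {y} \<partial>count_space ?H)"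
    by (rule nn_integral_cong) (use cyl in auto)
  also have "\<dots> = (\<integral>\<^sup>+f. emeasure ?Q (?cyl n f) \<partial>count_space ?H) * emeasure (jump \<omega> u) {y}"
    by (rule nn_integral_multc) auto
  also have "(\<integral>\<^sup>+f. emeasure ?Q (?cyl n f) \<partial>count_space ?H) = emeasure ?Q {X. X n = u}"
    unfolding un by (intro emeasure_UN_countable[symmetric] cH disj) (simp add: cylinder_sets)
  finally show ?thesis .
qed

lemma emeasure_quenched_pass:
  assumes \<omega>: "\<omega> \<in> space env_space"
  shows "emeasure (quenched_law \<omega> x) {X. X n = y} = ennreal (pass \<omega> x n y)"
proof (induction n arbitrary: y)
  case 0
  have "{X. X 0 = y} = {X :: nat \<Rightarrow> site. \<forall>i\<le>0. X i = y}" by auto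
  then show ?case
    using emeasure_quenched_law_cylinder[OF \<omega>, of x 0 "\<lambda>_. y"] by simp
next
  case (Suc n)
  let ?Q = "quenched_law \<omega> x"
  have [simp]: "sets ?Q = sets path_space" by (rule sets_quenched_law[OF \<omega>])
  have jump: "emeasure (jump \<omega> u) {y} = (\<Sum>z\<in>steps. ennreal (\<omega> u z) * indicator {y - z} u)" for u
  proof -
    have "u + z \<in> {y} \<longleftrightarrow> u = y - z" for z by (simp add: eq_diff_eq)
    then have "{z \<in> steps. u + z \<in> {y}} = {z \<in> steps. u = y - z}" by simp
    then have "emeasure (jump \<omega> u) {y} = (\<Sum>z\<in>steps. if u = y - z then ennreal (\<omega> u z) else 0)"
      by (simp only: emeasure_jump sum.inter_filter[OF finite_steps])
    also have "\<dots> = (\<Sum>z\<in>steps. ennreal (\<omega> u z) * indicator {y - z} u)"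
      by (rule sum.cong) simp_all
    finally show ?thesis .
  qed
  have "{X. X (Suc n) = y} = (\<Union>u\<in>UNIV. {X. X n = u \<and> X (Suc n) = y})" by auto
  then have "emeasure ?Q {X. X (Suc n) = y} =
      (\<integral>\<^sup>+u. emeasure ?Q {X. X n = u \<and> X (Suc n) = y} \<partial>count_space UNIV)"
  proof (simp only:, intro emeasure_UN_countable)
    show "{X. X n = u \<and> X (Suc n) = y} \<in> sets ?Q" for u
      using sets.Int[OF walk_event_sets[of n "{u}"] walk_event_sets[of "Suc n" "{y}"]]
      by (simp add: Int_def)
  qed (auto simp: disjoint_family_on_def)
  also have "\<dots> = (\<integral>\<^sup>+u. (\<Sum>z\<in>steps. ennreal (pass \<omega> x n u) * ennreal (\<omega> u z) * indicator {y - z} u) \<partial>count_space UNIV)"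
    by (intro nn_integral_cong) (simp only: emeasure_quenched_transition[OF \<omega>] Suc jump sum_distrib_left mult.assoc)
  also have "\<dots> = (\<Sum>z\<in>steps. \<integral>\<^sup>+u. ennreal (pass \<omega> x n u) * ennreal (\<omega> u z) * indicator {y - z} u \<partial>count_space UNIV)"
    by (rule nn_integral_sum) auto
  also have "\<dots> = (\<Sum>z\<in>steps. ennreal (pass \<omega> x n (y - z)) * ennreal (\<omega> (y - z) z))"
    by (intro sum.cong refl) (subst nn_integral_indicator_singleton, auto)
  also have "\<dots> = ennreal (pass \<omega> x (Suc n) y)"
    using pass_nonneg[of \<omega>] env_nonneg[OF \<omega>]
    by (simp add: ennreal_mult[symmetric] del: split_paired_All)
  finally show ?case .
qed

lemma measure_quenched_velocity:
  assumes \<omega>: "\<omega> \<in> space env_space" and G: "G \<in> sets borel"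
  shows "measure (distr (quenched_law \<omega> x) borel (empirical_velocity n)) G =
    (\<Sum>y\<in>{y \<in> reach x n. (1 / real n) *\<^sub>R real_site y \<in> G}. pass \<omega> x n y)"
proof -
  let ?Q = "quenched_law \<omega> x"
  have sQ [simp]: "sets ?Q = sets path_space" by (rule sets_quenched_law[OF \<omega>])
  then have [simp]: "space ?Q = UNIV" using sets_eq_imp_space_eq[OF sQ] by (simp add: space_PiM)
  interpret Q: prob_space ?Q by (rule prob_space_quenched_law[OF \<omega>])
  have nonneg: "0 \<le> pass \<omega> x n y" for y
    by (rule pass_nonneg) (rule env_nonneg[OF \<omega>])
  have fin: "measure ?Q {X. X n \<in> T} = (\<Sum>y\<in>T. pass \<omega> x n y)" if "finite T" for T
  proof -
    have "measure ?Q (\<Union>y\<in>T. {X. X n = y}) = (\<Sum>y\<in>T. measure ?Q {X. X n = y})"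
      using walk_event_sets[of n "{y}" for y] that
      by (intro Q.finite_measure_finite_Union) (auto simp: disjoint_family_on_def)
    also have "(\<Union>y\<in>T. {X. X n = y}) = {X. X n \<in> T}" by auto
    finally show ?thesis
      using emeasure_quenched_pass[OF \<omega>, of x n] nonneg by (simp add: measure_def)
  qed
  let ?T = "{y \<in> reach x n. (1 / real n) *\<^sub>R real_site y \<in> G}"
  have "measure ?Q {X. X n \<in> reach x n} = 1"
    using fin[of "reach x n"] sum_pass_const[of \<omega> x n] env_sum[OF \<omega>] by simp
  then have AE: "AE X in ?Q. X n \<in> reach x n"
    using Q.AE_in_set_eq_1[of "{X. X n \<in> reach x n}"] by simp
  have m: "empirical_velocity n \<in> ?Q \<rightarrow>\<^sub>M borel"
    using measurable_empirical_velocity by (simp add: measurable_cong_sets[OF sQ refl])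
  have "measure (distr ?Q borel (empirical_velocity n)) G = measure ?Q (empirical_velocity n -` G)"
    using measure_distr[OF m G] by simp
  also have "\<dots> = measure ?Q {X. X n \<in> ?T}"
  proof (rule measure_eq_AE)
    show "AE X in ?Q. X \<in> empirical_velocity n -` G \<longleftrightarrow> X \<in> {X. X n \<in> ?T}"
      using AE by eventually_elim (auto simp: empirical_velocity_def)
    show "empirical_velocity n -` G \<in> sets ?Q" using measurable_sets[OF m G] by simp
    show "{X. X n \<in> ?T} \<in> sets ?Q" unfolding sQ by (rule walk_event_sets)
  qed
  finally show ?thesis using fin[of ?T] by simp
qed

context iid_env
begin

abbreviation mean_step :: "site \<Rightarrow> real" where
  "mean_step z \<equiv> expectation (\<lambda>\<omega>. \<omega> 0 z)"

lemma mean_step_nonneg: "z \<in> steps \<Longrightarrow> 0 \<le> mean_step z"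
  by (intro integral_nonneg_AE AE_I2 env_nonneg) (simp_all add: space_P)

lemma expectation_pass_prod:
  fixes \<gamma> :: "site \<Rightarrow> env \<Rightarrow> real"
  assumes \<gamma>: "\<And>u. local_fun {u} (\<gamma> u)" and 1: "\<And>u. expectation (\<gamma> u) = 1"
  shows "expectation (\<lambda>\<omega>. pass (\<lambda>u z. c z * \<omega> u z) x n y * (\<Prod>u\<in>(\<Union>i<n. reach x i). \<gamma> u \<omega>)) =
    pass (\<lambda>u z. c z * expectation (\<lambda>\<omega>. \<omega> u z * \<gamma> u \<omega>)) x n y"
proof (induction n arbitrary: y)
  case 0
  then show ?case by (simp add: prob_space)
next
  case (Suc n)
  let ?S = "\<lambda>n. \<Union>i<n. reach x i" and ?Z = "\<lambda>\<omega>. pass (\<lambda>u z. c z * \<omega> u z) x n"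
  let ?A = "slab (snd x) (snd x + int n)"
  have prod_local: "local_fun A (\<lambda>\<omega>. \<Prod>u\<in>S. \<gamma> u \<omega>)" if "finite S" "S \<subseteq> A" for S A
    using that by (intro local_fun_prod local_fun_mono[OF \<gamma>]) auto
  have S_Suc: "(\<Prod>u\<in>?S (Suc n). \<gamma> u \<omega>) = (\<Prod>u\<in>?S n. \<gamma> u \<omega>) * (\<Prod>u\<in>reach x n. \<gamma> u \<omega>)" for \<omega>
  proof -
    have "?S n \<inter> reach x n = {}" by (auto simp: mem_reach)
    moreover have "?S (Suc n) = ?S n \<union> reach x n" by (auto simp: less_Suc_eq)
    ultimately show ?thesis by (simp add: prod.union_disjoint)
  qed
  have SA: "?S n \<subseteq> ?A" by (auto simp: mem_reach slab_def)
  have loc1: "local_fun ?A (\<lambda>\<omega>. ?Z \<omega> u * (\<Prod>u\<in>?S n. \<gamma> u \<omega>))" for u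
    using SA by (intro local_fun_mult local_fun_pass prod_local) auto
  have int: "integrable P (\<lambda>\<omega>. ?Z \<omega> (y - z) * (c z * \<omega> (y - z) z) * (\<Prod>u\<in>?S (Suc n). \<gamma> u \<omega>))"
    if "z \<in> steps" for z
  proof (rule local_fun_integrable)
    have "local_fun UNIV (\<lambda>\<omega>. ?Z \<omega> (y - z))" for y using local_fun_mono[OF local_fun_pass subset_UNIV] by blast
    then show "local_fun UNIV (\<lambda>\<omega>. ?Z \<omega> (y - z) * (c z * \<omega> (y - z) z) * (\<Prod>u\<in>?S (Suc n). \<gamma> u \<omega>))"
      using that by (intro local_fun_mult local_fun_const local_fun_env prod_local) simp_all
  qed
  have "expectation (\<lambda>\<omega>. ?Z \<omega> (y - z) * (c z * \<omega> (y - z) z) * (\<Prod>u\<in>?S (Suc n). \<gamma> u \<omega>)) =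
      pass (\<lambda>u z. c z * expectation (\<lambda>\<omega>. \<omega> u z * \<gamma> u \<omega>)) x n (y - z) *
      (c z * expectation (\<lambda>\<omega>. \<omega> (y - z) z * \<gamma> (y - z) \<omega>))" if z: "z \<in> steps" for z
  proof (cases "y - z \<in> reach x n")
    case True
    define u where "u = y - z"
    have u: "u \<in> reach x n" using True by (simp add: u_def)
    let ?R = "reach x n - {u}"
    have loc2: "local_fun {u} (\<lambda>\<omega>. c z * (\<omega> u z * \<gamma> u \<omega>))"
      using z by (intro local_fun_mult local_fun_const local_fun_env \<gamma>) auto
    have loc3: "local_fun ?R (\<lambda>\<omega>. \<Prod>v\<in>?R. \<gamma> v \<omega>)" by (intro prod_local) auto
    have loc23: "local_fun (reach x n) (\<lambda>\<omega>. (c z * (\<omega> u z * \<gamma> u \<omega>)) * (\<Prod>v\<in>?R. \<gamma> v \<omega>))"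
      using u by (intro local_fun_mult[OF local_fun_mono[OF loc2] local_fun_mono[OF loc3]]) auto
    have "expectation (\<lambda>\<omega>. ?Z \<omega> u * (c z * \<omega> u z) * (\<Prod>u\<in>?S (Suc n). \<gamma> u \<omega>)) =
      expectation (\<lambda>\<omega>. (?Z \<omega> u * (\<Prod>u\<in>?S n. \<gamma> u \<omega>)) * ((c z * (\<omega> u z * \<gamma> u \<omega>)) * (\<Prod>v\<in>?R. \<gamma> v \<omega>)))"
      by (subst S_Suc, subst prod.remove[OF _ u]) (simp_all add: mult_ac)
    also have "\<dots> = expectation (\<lambda>\<omega>. ?Z \<omega> u * (\<Prod>u\<in>?S n. \<gamma> u \<omega>)) *
        expectation (\<lambda>\<omega>. (c z * (\<omega> u z * \<gamma> u \<omega>)) * (\<Prod>v\<in>?R. \<gamma> v \<omega>))"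
      by (rule expectation_mult[OF loc1 loc23]) (auto simp: slab_def mem_reach)
    also have "expectation (\<lambda>\<omega>. (c z * (\<omega> u z * \<gamma> u \<omega>)) * (\<Prod>v\<in>?R. \<gamma> v \<omega>)) =
        expectation (\<lambda>\<omega>. c z * (\<omega> u z * \<gamma> u \<omega>)) * expectation (\<lambda>\<omega>. \<Prod>v\<in>?R. \<gamma> v \<omega>)"
      by (rule expectation_mult[OF loc2 loc3]) auto
    also have "expectation (\<lambda>\<omega>. \<Prod>v\<in>?R. \<gamma> v \<omega>) = 1"
      by (subst expectation_prod) (auto simp: \<gamma> 1)
    finally show ?thesis by (simp add: Suc u_def)
  qed (simp add: pass_eq_0)
  then show ?case
    using int by (simp add: sum_distrib_right Bochner_Integration.integral_sum)
qed

lemma expectation_step: "z \<in> steps \<Longrightarrow> expectation (\<lambda>\<omega>. \<omega> u z) = mean_step z"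
  by (rule expectation_site[of "\<lambda>p. p z"])
     (simp add: prob_vector_space_def measurable_restrict_space1)

lemma expectation_pass:
  "expectation (\<lambda>\<omega>. pass (\<lambda>u z. c z * \<omega> u z) x n y) = pass (\<lambda>_ z. c z * mean_step z) x n y"
proof -
  have "expectation (\<lambda>\<omega>. pass (\<lambda>u z. c z * \<omega> u z) x n y) =
      pass (\<lambda>u z. c z * expectation (\<lambda>\<omega>. \<omega> u z)) x n y"
    using expectation_pass_prod[of "\<lambda>_ _. 1" c x n y] by (simp add: prob_space)
  also have "\<dots> = pass (\<lambda>_ z. c z * mean_step z) x n y"
    by (intro pass_cong arg_cong[where f = "(*) _"] expectation_step)
  finally show ?thesis .
qed

lemma measure_averaged_velocity:
  assumes G: "G \<in> sets borel"
  shows "measure (distr (averaged_law P x) borel (empirical_velocity n)) G =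
    (\<Sum>y\<in>{y \<in> reach x n. (1 / real n) *\<^sub>R real_site y \<in> G}. pass (\<lambda>_. mean_step) x n y)"
    and "measure (distr (averaged_law P x) borel (empirical_velocity n)) G =
    expectation (\<lambda>\<omega>. measure (distr (quenched_law \<omega> x) borel (empirical_velocity n)) G)"
proof -
  let ?A = "averaged_law P x" and ?T = "{y \<in> reach x n. (1 / real n) *\<^sub>R real_site y \<in> G}"
  note sets_avg = sets_averaged_law[OF prob_space_P sets_P, of x]
  have m: "empirical_velocity n \<in> ?A \<rightarrow>\<^sub>M borel"
    using measurable_empirical_velocity by (simp add: measurable_cong_sets[OF sets_avg refl])
  have spA: "space ?A = UNIV" using sets_eq_imp_space_eq[OF sets_avg] by (simp add: space_PiM)
  have vG: "empirical_velocity n -` G \<in> sets path_space"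
    using measurable_sets[OF measurable_empirical_velocity G] by (simp add: space_PiM)
  have nonneg: "0 \<le> pass \<omega> x n y" if "\<omega> \<in> space env_space" for \<omega> y
    by (rule pass_nonneg) (rule env_nonneg[OF that])
  have quenched: "emeasure (quenched_law \<omega> x) (empirical_velocity n -` G) = ennreal (\<Sum>y\<in>?T. pass \<omega> x n y)"
    if \<omega>: "\<omega> \<in> space env_space" for \<omega>
  proof -
    interpret Q: prob_space "quenched_law \<omega> x" by (rule prob_space_quenched_law[OF \<omega>])
    have sQ: "sets (quenched_law \<omega> x) = sets path_space" by (rule sets_quenched_law[OF \<omega>])
    have "empirical_velocity n \<in> quenched_law \<omega> x \<rightarrow>\<^sub>M borel"
      using measurable_empirical_velocity by (simp add: measurable_cong_sets[OF sQ refl])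
    from measure_distr[OF this G] show ?thesis
      using measure_quenched_velocity[OF \<omega> G, of x n] sets_eq_imp_space_eq[OF sQ]
      by (simp add: Q.emeasure_eq_measure space_PiM)
  qed
  have loc: "local_fun (slab (snd x) (snd x + int n)) (\<lambda>\<omega>. pass \<omega> x n y)" for y
    using local_fun_pass[of x n "\<lambda>_. 1" y] by simp
  have int: "integrable P (\<lambda>\<omega>. pass \<omega> x n y)" for y
    by (rule local_fun_integrable[OF loc])
  have nonneg_avg: "0 \<le> expectation (\<lambda>\<omega>. \<Sum>y\<in>?T. pass \<omega> x n y)"
    by (intro integral_nonneg_AE AE_I2 sum_nonneg nonneg) (simp add: space_P)
  have "emeasure ?A (empirical_velocity n -` G) = (\<integral>\<^sup>+\<omega>. ennreal (\<Sum>y\<in>?T. pass \<omega> x n y) \<partial>P)"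
    unfolding emeasure_averaged_law[OF prob_space_P sets_P vG]
    by (intro nn_integral_cong quenched) (simp add: space_P)
  also have "\<dots> = ennreal (expectation (\<lambda>\<omega>. \<Sum>y\<in>?T. pass \<omega> x n y))"
    by (rule nn_integral_eq_integral) (auto intro!: int AE_I2 sum_nonneg nonneg simp: space_P)
  finally have eq: "measure (distr ?A borel (empirical_velocity n)) G = expectation (\<lambda>\<omega>. \<Sum>y\<in>?T. pass \<omega> x n y)"
    using measure_distr[OF m G] nonneg_avg by (simp add: spA measure_def)
  have "\<dots> = (\<Sum>y\<in>?T. pass (\<lambda>_. mean_step) x n y)"
    using int expectation_pass[of "\<lambda>_. 1" x n] by (simp add: Bochner_Integration.integral_sum)
  with eq show "measure (distr ?A borel (empirical_velocity n)) G = (\<Sum>y\<in>?T. pass (\<lambda>_. mean_step) x n y)"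
    by simp
  show "measure (distr ?A borel (empirical_velocity n)) G =
      expectation (\<lambda>\<omega>. measure (distr (quenched_law \<omega> x) borel (empirical_velocity n)) G)"
    unfolding eq using measure_quenched_velocity[OF _ G, of _ x n]
    by (intro Bochner_Integration.integral_cong) (auto simp: space_P)
qed

end

subsection \<open>Fractional moments of the tilted path sums\<close>

lemma exp_le_quadratic:
  fixes s :: real
  assumes "\<bar>s\<bar> \<le> 1"
  shows "exp s \<le> 1 + s + s\<^sup>2"
proof (cases "0 \<le> s")
  case True
  then show ?thesis using exp_bound[of s] assms by simp
next
  case False
  define t where "t = - s"
  have t: "0 \<le> t" "t \<le> 1" using False assms by (auto simp: t_def)
  have "1 \<le> (1 - t + t\<^sup>2) * (1 + t)"
    using t by (simp add: algebra_simps power2_eq_square)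
  then have "1 / (1 + t) \<le> 1 - t + t\<^sup>2"
    using t by (simp add: divide_le_eq)
  moreover have "exp (- t) \<le> 1 / (1 + t)"
    using t exp_ge_add_one_self[of t] by (simp add: exp_minus inverse_eq_divide frac_le)
  ultimately show ?thesis by (simp add: t_def)
qed

lemma cosh_add_le:
  fixes b s :: real
  assumes "\<bar>s\<bar> \<le> 1"
  shows "cosh (b + s) \<le> (1 + s\<^sup>2) * cosh b + s * sinh b"
proof -
  have "exp b * exp s \<le> exp b * (1 + s + s\<^sup>2)" "exp (- b) * exp (- s) \<le> exp (- b) * (1 - s + s\<^sup>2)"
    using exp_le_quadratic[of s] exp_le_quadratic[of "- s"] assms by (auto intro!: mult_left_mono)
  then have "(exp b * exp s + exp (- b) * exp (- s)) / 2 \<le>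
      (exp b * (1 + s + s\<^sup>2) + exp (- b) * (1 - s + s\<^sup>2)) / 2"
    by (intro divide_right_mono add_mono) auto
  also have "\<dots> = (1 + s\<^sup>2) * cosh b + s * sinh b"
    by (simp add: cosh_field_def sinh_field_def field_simps)
  finally show ?thesis
    by (simp add: cosh_field_def exp_add[symmetric])
qed

lemma abs_sinh_le_cosh: "\<bar>sinh x\<bar> \<le> cosh (x :: real)"
  using sinh_le_cosh_real[of x] sinh_le_cosh_real[of "- x"] by simp

lemma sum_cosh_step_le:
  fixes q d :: "site \<Rightarrow> real"
  assumes q: "\<And>z. z \<in> steps \<Longrightarrow> 0 \<le> q z" and q1: "(\<Sum>z\<in>steps. q z) \<le> 1"
    and drift: "\<bar>\<Sum>z\<in>steps. q z * d z\<bar> \<le> \<eta>" and d: "\<And>z. z \<in> steps \<Longrightarrow> \<bar>d z\<bar> \<le> 2"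
    and \<eta>: "0 < \<eta>" "\<eta> \<le> 1 / 2"
  shows "(\<Sum>z\<in>steps. q z * cosh (\<eta> * (a + d z))) \<le> (1 + 5 * \<eta>\<^sup>2) * cosh (\<eta> * a)"
proof -
  let ?b = "\<eta> * a"
  have "cosh (\<eta> * (a + d z)) \<le> (1 + 4 * \<eta>\<^sup>2) * cosh ?b + \<eta> * d z * sinh ?b" if "z \<in> steps" for z
  proof -
    have "\<bar>\<eta> * d z\<bar> \<le> \<eta> * 2" using d[OF that] \<eta> by (simp add: abs_mult)
    then have "(\<eta> * d z)\<^sup>2 \<le> (\<eta> * 2)\<^sup>2" "\<bar>\<eta> * d z\<bar> \<le> 1"
      using \<eta> abs_le_square_iff[of "\<eta> * d z" "\<eta> * 2"] by auto
    then have "(1 + (\<eta> * d z)\<^sup>2) * cosh ?b \<le> (1 + 4 * \<eta>\<^sup>2) * cosh ?b"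
      by (intro mult_right_mono) (auto simp: power_mult_distrib)
    with cosh_add_le[of "\<eta> * d z" ?b] \<open>\<bar>\<eta> * d z\<bar> \<le> 1\<close> show ?thesis
      unfolding distrib_left by linarith
  qed
  then have "(\<Sum>z\<in>steps. q z * cosh (\<eta> * (a + d z))) \<le>
      (\<Sum>z\<in>steps. q z * ((1 + 4 * \<eta>\<^sup>2) * cosh ?b + \<eta> * d z * sinh ?b))"
    by (intro sum_mono mult_left_mono q)
  also have "\<dots> = (\<Sum>z\<in>steps. q z) * ((1 + 4 * \<eta>\<^sup>2) * cosh ?b) + \<eta> * ((\<Sum>z\<in>steps. q z * d z) * sinh ?b)"
    unfolding sum_steps by (simp add: algebra_simps)
  also have "\<dots> \<le> 1 * ((1 + 4 * \<eta>\<^sup>2) * cosh ?b) + \<eta> * (\<eta> * cosh ?b)"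
  proof (intro add_mono mult_right_mono mult_left_mono q1)
    have "\<bar>(\<Sum>z\<in>steps. q z * d z) * sinh ?b\<bar> \<le> \<eta> * cosh ?b"
      unfolding abs_mult using drift abs_sinh_le_cosh[of ?b] \<eta> by (intro mult_mono) auto
    then show "(\<Sum>z\<in>steps. q z * d z) * sinh ?b \<le> \<eta> * cosh ?b" by linarith
  qed (use \<eta> in auto)
  finally show ?thesis by (simp add: algebra_simps power2_eq_square)
qed

text \<open>\<open>(1 - \<epsilon>) ^ j\<close> accounts for walks that stay in the tube \<open>\<bar>a\<bar> \<le> L\<close>, where each step costs a factor
  \<open>1 - \<epsilon>\<close>. Outside the tube the \<open>cosh\<close> term is at least 1, and its surplus growth
  (6 instead of the 5 of \<open>sum_cosh_step_le\<close>) pays for the missing loss.\<close>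
lemma tube_supersolution_step:
  fixes q d :: "site \<Rightarrow> real"
  assumes q: "\<And>z. z \<in> steps \<Longrightarrow> 0 \<le> q z"
    and mass: "(\<Sum>z\<in>steps. q z) = 1 - (if \<bar>a\<bar> \<le> L then \<epsilon> else 0)"
    and drift: "\<bar>\<Sum>z\<in>steps. q z * d z\<bar> \<le> \<eta>" and d: "\<And>z. z \<in> steps \<Longrightarrow> \<bar>d z\<bar> \<le> 2"
    and \<eta>: "0 < \<eta>" "\<eta> \<le> 1 / 2" and \<epsilon>: "0 \<le> \<epsilon>" "\<epsilon> \<le> \<eta>\<^sup>2" and L: "0 \<le> L"
  shows "(\<Sum>z\<in>steps. q z * ((1 - \<epsilon>) ^ j + (1 + 6 * \<eta>\<^sup>2) ^ j * cosh (\<eta> * (a + d z)) / cosh (\<eta> * L)))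
    \<le> (1 - \<epsilon>) ^ Suc j + (1 + 6 * \<eta>\<^sup>2) ^ Suc j * cosh (\<eta> * a) / cosh (\<eta> * L)"
proof -
  let ?A = "(1 - \<epsilon>) ^ j" and ?B = "(1 + 6 * \<eta>\<^sup>2) ^ j" and ?W = "cosh (\<eta> * a) / cosh (\<eta> * L)"
  have "\<eta>\<^sup>2 \<le> (1 / 2)\<^sup>2" using \<eta> by (intro power_mono) auto
  then have \<epsilon>1: "\<epsilon> \<le> 1" using \<epsilon> by (simp add: power2_eq_square)
  have A: "0 \<le> ?A" "?A \<le> 1" using \<epsilon> \<epsilon>1 by (auto intro: power_le_one)
  have B: "1 \<le> ?B" by (rule one_le_power) simp
  have W: "0 \<le> ?W" by simp
  have "(\<Sum>z\<in>steps. q z * (?A + ?B * cosh (\<eta> * (a + d z)) / cosh (\<eta> * L))) =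
      ?A * (\<Sum>z\<in>steps. q z) + ?B / cosh (\<eta> * L) * (\<Sum>z\<in>steps. q z * cosh (\<eta> * (a + d z)))"
    unfolding sum_steps by (simp add: field_simps)
  also have "\<dots> \<le> ?A * (\<Sum>z\<in>steps. q z) + ?B / cosh (\<eta> * L) * ((1 + 5 * \<eta>\<^sup>2) * cosh (\<eta> * a))"
    using mass \<epsilon> B by (intro add_left_mono mult_left_mono sum_cosh_step_le q drift d \<eta>) auto
  also have "\<dots> = ?A * (\<Sum>z\<in>steps. q z) + (1 + 5 * \<eta>\<^sup>2) * (?B * ?W)" by simp
  also have "\<dots> \<le> ?A * (1 - \<epsilon>) + (1 + 6 * \<eta>\<^sup>2) * (?B * ?W)"
  proof (cases "\<bar>a\<bar> \<le> L")
    case True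
    have "(1 + 5 * \<eta>\<^sup>2) * (?B * ?W) \<le> (1 + 6 * \<eta>\<^sup>2) * (?B * ?W)"
      using B W by (intro mult_right_mono mult_nonneg_nonneg) auto
    with True show ?thesis using mass by simp
  next
    case False
    then have "cosh (\<eta> * L) \<le> cosh (\<eta> * \<bar>a\<bar>)"
      using \<eta> L by (subst cosh_real_nonneg_le_iff) auto
    also have "\<dots> = cosh (\<eta> * a)" using cosh_real_abs[of "\<eta> * a"] \<eta> by (simp add: abs_mult)
    finally have "1 \<le> ?W" by simp
    then have "1 \<le> ?B * ?W" using B mult_mono[of 1 ?B 1 ?W] by simp
    then have "\<eta>\<^sup>2 * 1 \<le> \<eta>\<^sup>2 * (?B * ?W)" by (intro mult_left_mono) auto
    moreover have "?A * \<epsilon> \<le> 1 * \<eta>\<^sup>2" using A \<epsilon> by (intro mult_mono) auto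
    ultimately have "?A * \<epsilon> \<le> \<eta>\<^sup>2 * (?B * ?W)" by simp
    moreover have "?A * (\<Sum>z\<in>steps. q z) = ?A * (1 - \<epsilon>) + ?A * \<epsilon>"
      using False mass by (simp add: algebra_simps)
    moreover have "(1 + 6 * \<eta>\<^sup>2) * X = (1 + 5 * \<eta>\<^sup>2) * X + \<eta>\<^sup>2 * X" for X
      by (simp add: algebra_simps)
    note this[of "?B * ?W"]
    ultimately show ?thesis by linarith
  qed
  finally show ?thesis by (simp add: mult_ac)
qed

lemma card_int_interval_le:
  fixes \<alpha> L :: real
  assumes "0 \<le> L"
  shows "finite {j :: int. \<bar>of_int j - \<alpha>\<bar> \<le> L}" "real (card {j :: int. \<bar>of_int j - \<alpha>\<bar> \<le> L}) \<le> 2 * L + 1"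
proof -
  have eq: "{j :: int. \<bar>of_int j - \<alpha>\<bar> \<le> L} = {\<lceil>\<alpha> - L\<rceil>..\<lfloor>\<alpha> + L\<rfloor>}"
    by (auto simp: abs_le_iff le_floor_iff ceiling_le_iff)
  show "finite {j :: int. \<bar>of_int j - \<alpha>\<bar> \<le> L}" unfolding eq by simp
  have "real (card {\<lceil>\<alpha> - L\<rceil>..\<lfloor>\<alpha> + L\<rfloor>}) = max 0 (of_int (\<lfloor>\<alpha> + L\<rfloor> - \<lceil>\<alpha> - L\<rceil> + 1))"
    by (simp add: of_nat_nat max_def)
  also have "\<dots> \<le> 2 * L + 1"
    using assms by (simp; linarith)
  finally show "real (card {j :: int. \<bar>of_int j - \<alpha>\<bar> \<le> L}) \<le> 2 * L + 1" unfolding eq .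
qed

locale weighted_iid_env = iid_env +
  fixes c :: "site \<Rightarrow> real"
  assumes c_nonneg: "\<And>z. z \<in> steps \<Longrightarrow> 0 \<le> c z"
    and c_mean: "(\<Sum>z\<in>steps. c z * mean_step z) = 1"
begin

abbreviation Z :: "site \<Rightarrow> nat \<Rightarrow> site \<Rightarrow> env \<Rightarrow> real" where
  "Z x n y \<omega> \<equiv> pass (\<lambda>u z. c z * \<omega> u z) x n y"

definition dev :: "site \<Rightarrow> env \<Rightarrow> real" where
  "dev u \<omega> = (\<Sum>z\<in>steps. c z * \<omega> u z) - 1"

definition M :: real where "M = 1 + (\<Sum>z\<in>steps. c z)"
definition V :: real where "V = expectation (\<lambda>\<omega>. (dev 0 \<omega>)\<^sup>2)"
definition vel :: real where "vel = (\<Sum>z\<in>steps. c z * mean_step z * of_int (fst z))"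

lemma M_ge_1: "1 \<le> M"
  unfolding M_def using sum_nonneg[of steps c] c_nonneg by simp

lemma local_fun_dev: "local_fun {u} (dev u)"
proof -
  have "local_fun {u} (\<lambda>\<omega>. (\<Sum>z\<in>steps. c z * \<omega> u z) + - 1)"
    by (intro local_fun_add local_fun_sum local_fun_mult local_fun_const local_fun_env) auto
  then show ?thesis by (simp add: dev_def[abs_def])
qed

lemma abs_dev_le: "\<omega> \<in> space env_space \<Longrightarrow> \<bar>dev u \<omega>\<bar> \<le> M"
proof -
  assume \<omega>: "\<omega> \<in> space env_space"
  have "0 \<le> (\<Sum>z\<in>steps. c z * \<omega> u z)"
    by (intro sum_nonneg mult_nonneg_nonneg c_nonneg env_nonneg[OF \<omega>])
  moreover have "(\<Sum>z\<in>steps. c z * \<omega> u z) \<le> (\<Sum>z\<in>steps. c z)"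
    by (intro sum_mono mult_left_le c_nonneg env_le_1[OF \<omega>])
  ultimately show ?thesis by (simp add: dev_def M_def)
qed

lemma expectation_dev: "expectation (dev u) = 0"
proof -
  have int: "integrable P (\<lambda>\<omega>. \<omega> u z)" if "z \<in> steps" for z
    by (rule local_fun_integrable[OF local_fun_env[of z u "{u}"]]) (use that in auto)
  have "expectation (dev u) = (\<Sum>z\<in>steps. c z * expectation (\<lambda>\<omega>. \<omega> u z)) - 1"
    unfolding dev_def[abs_def] using int
    by (subst Bochner_Integration.integral_diff) (auto simp: Bochner_Integration.integral_sum prob_space)
  also have "(\<Sum>z\<in>steps. c z * expectation (\<lambda>\<omega>. \<omega> u z)) = (\<Sum>z\<in>steps. c z * mean_step z)"
    by (intro sum.cong arg_cong[where f = "(*) _"] expectation_step refl)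
  finally show ?thesis using c_mean by simp
qed

lemma component_measurable: "z \<in> steps \<Longrightarrow> (\<lambda>p. p z) \<in> borel_measurable prob_vector_space"
  unfolding prob_vector_space_def
  by (intro measurable_restrict_space1 measurable_component_singleton)

lemma expectation_dev2: "expectation (\<lambda>\<omega>. (dev u \<omega>)\<^sup>2) = V"
proof -
  have "(\<lambda>p. ((\<Sum>z\<in>steps. c z * p z) - 1)\<^sup>2) \<in> borel_measurable prob_vector_space"
    using component_measurable by (intro borel_measurable_power borel_measurable_diff borel_measurable_sum
      borel_measurable_times) auto
  from expectation_site[OF this, of u] show ?thesis by (simp add: V_def dev_def)
qed

lemma V_nonneg: "0 \<le> V"
  unfolding V_def by simp

lemma abs_vel_le: "\<bar>vel\<bar> \<le> 1"
proof -
  have "\<bar>vel\<bar> \<le> (\<Sum>z\<in>steps. \<bar>c z * mean_step z * of_int (fst z)\<bar>)"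
    unfolding vel_def by (rule sum_abs)
  also have "\<dots> = (\<Sum>z\<in>steps. c z * mean_step z)"
    using c_nonneg mean_step_nonneg by (intro sum.cong refl) (auto simp: steps_def abs_mult)
  finally show ?thesis using c_mean by simp
qed

lemma abs_step_vel_le: "z \<in> steps \<Longrightarrow> \<bar>of_int (fst z) - vel\<bar> \<le> 2"
  using abs_vel_le by (auto simp: steps_def)

lemma sum_step_vel: "(\<Sum>z\<in>steps. c z * mean_step z * (of_int (fst z) - vel)) = 0"
  using c_mean by (simp add: right_diff_distrib sum_subtractf vel_def flip: sum_distrib_right)

lemma Z_nonneg: "\<omega> \<in> space env_space \<Longrightarrow> 0 \<le> Z x n y \<omega>"
  by (intro pass_nonneg mult_nonneg_nonneg c_nonneg env_nonneg)

text \<open>The weight \<open>g\<close> below is a product over the sites of a tube of width \<open>L\<close> around the line of slope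
  \<open>vel\<close>; it tilts the environment against \<open>dev\<close>. The bound follows from
  \<open>sqrt W \<le> (t * (W * g) + 1 / (t * g)) / 2\<close>.\<close>
lemma sqrt_total_le:
  fixes \<eta> \<delta> L t :: real
  assumes \<eta>: "0 < \<eta>" "\<eta> \<le> 1 / 2" and \<delta>: "0 \<le> \<delta>" "2 * \<delta> * M \<le> \<eta>" "\<delta> * V \<le> \<eta>\<^sup>2"
    and L: "0 \<le> L" and t: "0 < t"
  shows "expectation (\<lambda>\<omega>. sqrt (\<Sum>y\<in>reach x m. Z x m y \<omega>)) \<le>
    (t * ((1 - \<delta> * V) ^ m + (1 + 6 * \<eta>\<^sup>2) ^ m / cosh (\<eta> * L)) +
     exp (2 * V * \<delta>\<^sup>2 * (real m * (2 * L + 1))) / t) / 2"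
proof -
  define pos where "pos u = of_int (fst u - fst x) - of_int (snd u - snd x) * vel" for u :: site
  define \<delta>' where "\<delta>' u = (if \<bar>pos u\<bar> \<le> L then \<delta> else 0)" for u
  define \<gamma> where "\<gamma> u \<omega> = 1 + (- \<delta>' u) * dev u \<omega>" for u \<omega>
  let ?S = "\<Union>i<m. reach x i"
  have \<delta>': "0 \<le> \<delta>' u" "\<delta>' u \<le> \<delta>" for u using \<delta> by (auto simp: \<delta>'_def)
  have small: "\<bar>\<delta>' u * dev u \<omega>\<bar> \<le> 1 / 4" if "\<omega> \<in> space env_space" for u \<omega>
  proof -
    have "\<bar>\<delta>' u * dev u \<omega>\<bar> \<le> \<delta> * M"
      unfolding abs_mult using \<delta>'[of u] \<delta> abs_dev_le[OF that, of u] by (intro mult_mono) auto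
    then show ?thesis using \<delta> \<eta> by simp
  qed
  have \<gamma>_ge: "1 / 2 \<le> \<gamma> u \<omega>" if "\<omega> \<in> space env_space" for u \<omega>
    using small[OF that, of u] by (simp add: \<gamma>_def abs_le_iff)
  have \<gamma>_nonneg: "0 \<le> \<gamma> u \<omega>" if "\<omega> \<in> space env_space" for u \<omega>
    using \<gamma>_ge[OF that, of u] by simp
  have loc: "local_fun {u} (\<gamma> u)" for u
    unfolding \<gamma>_def[abs_def] by (intro local_fun_add local_fun_mult local_fun_const local_fun_dev)
  have loc': "local_fun {u} (\<lambda>\<omega>. 1 / \<gamma> u \<omega>)" for u
    by (rule local_fun_inverse[OF loc _ \<gamma>_ge]) simp
  have int_dev: "integrable P (dev u)" for u
    by (rule local_fun_integrable[OF local_fun_dev])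
  have int_dev2: "integrable P (\<lambda>\<omega>. (dev u \<omega>)\<^sup>2)" for u
    unfolding power2_eq_square by (rule local_fun_integrable[OF local_fun_mult[OF local_fun_dev local_fun_dev]])
  have E\<gamma>: "expectation (\<gamma> u) = 1" for u
    unfolding \<gamma>_def[abs_def] using int_dev[of u] expectation_dev[of u] by (simp add: prob_space)
  have E\<gamma>': "expectation (\<lambda>\<omega>. 1 / \<gamma> u \<omega>) \<le> exp (2 * V * (\<delta>' u)\<^sup>2)" for u
  proof -
    have "1 / \<gamma> u \<omega> \<le> 1 + \<delta>' u * dev u \<omega> + 2 * (\<delta>' u)\<^sup>2 * (dev u \<omega>)\<^sup>2" if "\<omega> \<in> space P" for \<omega>
    proof -
      define s where "s = \<delta>' u * dev u \<omega>"
      have s: "\<bar>s\<bar> \<le> 1 / 4" using small[of \<omega> u] that by (simp add: s_def space_P)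
      then have "0 \<le> s\<^sup>2 * (1 - 2 * s)" by (intro mult_nonneg_nonneg) auto
      then have "1 \<le> (1 + s + 2 * s\<^sup>2) * (1 - s)" by (simp add: algebra_simps power2_eq_square)
      then have "1 / (1 - s) \<le> 1 + s + 2 * s\<^sup>2" using s by (simp add: divide_le_eq)
      then show ?thesis by (simp add: \<gamma>_def s_def power_mult_distrib)
    qed
    then have "expectation (\<lambda>\<omega>. 1 / \<gamma> u \<omega>) \<le>
        expectation (\<lambda>\<omega>. 1 + \<delta>' u * dev u \<omega> + 2 * (\<delta>' u)\<^sup>2 * (dev u \<omega>)\<^sup>2)"
      using int_dev int_dev2 by (intro integral_mono local_fun_integrable[OF loc']) auto
    also have "\<dots> = 1 + 2 * V * (\<delta>' u)\<^sup>2"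
      using int_dev int_dev2 by (simp add: prob_space expectation_dev expectation_dev2)
    also have "\<dots> \<le> exp (2 * V * (\<delta>' u)\<^sup>2)" by (rule exp_ge_add_one_self)
    finally show ?thesis .
  qed
  define g where "g \<omega> = (\<Prod>u\<in>?S. \<gamma> u \<omega>)" for \<omega>
  have g_pos: "0 < g \<omega>" if "\<omega> \<in> space env_space" for \<omega>
    unfolding g_def using \<gamma>_ge[OF that] by (intro prod_pos) (meson half_gt_zero zero_less_one order_less_le_trans)
  have loc_g: "local_fun UNIV g"
    unfolding g_def[abs_def] by (intro local_fun_prod local_fun_mono[OF loc subset_UNIV]) simp
  have "(\<lambda>\<omega>. 1 / g \<omega>) = (\<lambda>\<omega>. \<Prod>u\<in>?S. 1 / \<gamma> u \<omega>)"
    by (simp add: g_def prod_dividef)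
  then have loc_g': "local_fun UNIV (\<lambda>\<omega>. 1 / g \<omega>)"
    by (simp only:) (intro local_fun_prod local_fun_mono[OF loc' subset_UNIV], simp)
  have loc_Z: "local_fun UNIV (\<lambda>\<omega>. Z x n y \<omega>)" for n y
    by (rule local_fun_mono[OF local_fun_pass]) simp
  let ?W = "\<lambda>\<omega>. \<Sum>y\<in>reach x m. Z x m y \<omega>"
  have loc_W: "local_fun UNIV ?W" by (intro local_fun_sum loc_Z) simp
  have E_inv: "expectation (\<lambda>\<omega>. 1 / g \<omega>) \<le> exp (2 * V * \<delta>\<^sup>2 * (real m * (2 * L + 1)))"
  proof -
    have "expectation (\<lambda>\<omega>. 1 / g \<omega>) = (\<Prod>u\<in>?S. expectation (\<lambda>\<omega>. 1 / \<gamma> u \<omega>))"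
      using expectation_prod[of ?S "\<lambda>u \<omega>. 1 / \<gamma> u \<omega>"] loc' by (simp add: g_def prod_dividef)
    also have "\<dots> \<le> (\<Prod>u\<in>?S. exp (2 * V * (\<delta>' u)\<^sup>2))"
    proof (intro prod_mono conjI E\<gamma>')
      show "0 \<le> expectation (\<lambda>\<omega>. 1 / \<gamma> u \<omega>)" for u
        using \<gamma>_nonneg by (intro integral_nonneg_AE AE_I2) (simp add: space_P)
    qed
    also have "\<dots> = exp (\<Sum>u\<in>?S. 2 * V * (\<delta>' u)\<^sup>2)" by (simp add: exp_sum)
    also have "(\<Sum>u\<in>?S. 2 * V * (\<delta>' u)\<^sup>2) = (\<Sum>i<m. \<Sum>u\<in>reach x i. 2 * V * (\<delta>' u)\<^sup>2)"
      by (rule sum.UNION_disjoint) (auto simp: mem_reach)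
    also have "\<dots> \<le> (\<Sum>i<m. 2 * V * \<delta>\<^sup>2 * (2 * L + 1))"
    proof (rule sum_mono)
      fix i
      let ?T = "{u \<in> reach x i. \<bar>pos u\<bar> \<le> L}"
      let ?J = "{j :: int. \<bar>of_int j - (of_int (fst x) + real i * vel)\<bar> \<le> L}"
      have "card ?T = card (fst ` ?T)"
        by (rule card_image[symmetric]) (auto simp: inj_on_def mem_reach)
      also have "\<dots> \<le> card ?J"
        by (rule card_mono[OF card_int_interval_le(1)[OF L]]) (auto simp: mem_reach pos_def diff_diff_eq)
      finally have T: "real (card ?T) \<le> 2 * L + 1"
        using card_int_interval_le(2)[OF L, of "of_int (fst x) + real i * vel"] by linarith
      have "(\<Sum>u\<in>reach x i. 2 * V * (\<delta>' u)\<^sup>2) = (\<Sum>u\<in>?T. 2 * V * \<delta>\<^sup>2)"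
        by (rule sum.mono_neutral_cong_right) (auto simp: \<delta>'_def)
      also have "\<dots> = 2 * V * \<delta>\<^sup>2 * real (card ?T)" by simp
      also have "\<dots> \<le> 2 * V * \<delta>\<^sup>2 * (2 * L + 1)"
        using T V_nonneg by (intro mult_left_mono) auto
      finally show "(\<Sum>u\<in>reach x i. 2 * V * (\<delta>' u)\<^sup>2) \<le> 2 * V * \<delta>\<^sup>2 * (2 * L + 1)" .
    qed
    finally show ?thesis by (simp add: mult_ac)
  qed
  define q where "q u z = c z * expectation (\<lambda>\<omega>. \<omega> u z * \<gamma> u \<omega>)" for u z
  have int_step: "integrable P (\<lambda>\<omega>. \<omega> u z)" "integrable P (\<lambda>\<omega>. \<omega> u z * dev u \<omega>)"
    "integrable P (\<lambda>\<omega>. \<omega> u z * \<gamma> u \<omega>)" if "z \<in> steps" for u z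
    by (rule local_fun_integrable[where A = "{u}"],
        intro local_fun_mult local_fun_env local_fun_dev loc that, simp)+
  have q_nonneg: "0 \<le> q u z" if "z \<in> steps" for u z
    unfolding q_def
    by (intro mult_nonneg_nonneg integral_nonneg_AE AE_I2 c_nonneg \<gamma>_nonneg env_nonneg that)
       (simp_all add: space_P)
  define e where "e u z = c z * expectation (\<lambda>\<omega>. \<omega> u z * dev u \<omega>)" for u z
  have q_eq: "q u z = c z * mean_step z - \<delta>' u * e u z" if z: "z \<in> steps" for u z
  proof -
    have "expectation (\<lambda>\<omega>. \<omega> u z * \<gamma> u \<omega>) = expectation (\<lambda>\<omega>. \<omega> u z - \<delta>' u * (\<omega> u z * dev u \<omega>))"
      by (simp add: \<gamma>_def algebra_simps)
    also have "\<dots> = expectation (\<lambda>\<omega>. \<omega> u z) - \<delta>' u * expectation (\<lambda>\<omega>. \<omega> u z * dev u \<omega>)"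
      using int_step[OF z, of u] by simp
    finally show ?thesis
      unfolding expectation_step[OF z, of u] q_def e_def
      by (simp only: right_diff_distrib mult.left_commute[of "c z" "\<delta>' u"])
  qed
  have sum_e: "(\<Sum>z\<in>steps. e u z) = V" for u
  proof -
    have "(\<Sum>z\<in>steps. e u z) = expectation (\<lambda>\<omega>. \<Sum>z\<in>steps. c z * (\<omega> u z * dev u \<omega>))"
      unfolding e_def using int_step by (simp add: Bochner_Integration.integral_sum)
    also have "\<dots> = expectation (\<lambda>\<omega>. dev u \<omega> + (dev u \<omega>)\<^sup>2)"
    proof (intro Bochner_Integration.integral_cong refl)
      fix \<omega>
      have "(\<Sum>z\<in>steps. c z * (\<omega> u z * dev u \<omega>)) = (dev u \<omega> + 1) * dev u \<omega>"
        by (simp add: dev_def sum_distrib_right mult.assoc)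
      then show "(\<Sum>z\<in>steps. c z * (\<omega> u z * dev u \<omega>)) = dev u \<omega> + (dev u \<omega>)\<^sup>2"
        by (simp add: algebra_simps power2_eq_square)
    qed
    also have "\<dots> = V"
      using int_dev int_dev2 by (simp add: expectation_dev expectation_dev2)
    finally show ?thesis .
  qed
  have abs_e: "\<bar>e u z\<bar> \<le> c z * mean_step z * M" if z: "z \<in> steps" for u z
  proof -
    have "\<bar>expectation (\<lambda>\<omega>. \<omega> u z * dev u \<omega>)\<bar> \<le> expectation (\<lambda>\<omega>. \<bar>\<omega> u z * dev u \<omega>\<bar>)"
      by (rule integral_abs_bound)
    also have "\<dots> \<le> expectation (\<lambda>\<omega>. \<omega> u z * M)"
    proof (rule integral_mono)
      show "integrable P (\<lambda>\<omega>. \<bar>\<omega> u z * dev u \<omega>\<bar>)" "integrable P (\<lambda>\<omega>. \<omega> u z * M)"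
        using int_step[OF z, of u] by auto
      show "\<bar>\<omega> u z * dev u \<omega>\<bar> \<le> \<omega> u z * M" if "\<omega> \<in> space P" for \<omega>
        using that abs_dev_le[of \<omega> u] env_nonneg[of \<omega> z u] z
        by (auto simp: abs_mult space_P intro!: mult_left_mono)
    qed
    also have "\<dots> = expectation (\<lambda>\<omega>. \<omega> u z) * M" by simp
    also have "expectation (\<lambda>\<omega>. \<omega> u z) = mean_step z" by (rule expectation_step[OF z])
    finally show ?thesis
      using c_nonneg[OF z] by (simp add: e_def abs_mult mult.assoc mult_left_mono)
  qed
  let ?d = "\<lambda>z. of_int (fst z) - vel"
  have mass: "(\<Sum>z\<in>steps. q u z) = 1 - (if \<bar>pos u\<bar> \<le> L then \<delta> * V else 0)" for u
    using c_mean sum_e[of u] by (simp add: q_eq sum_subtractf \<delta>'_def flip: sum_distrib_left)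
  have drift: "\<bar>\<Sum>z\<in>steps. q u z * ?d z\<bar> \<le> \<eta>" for u
  proof -
    have "(\<Sum>z\<in>steps. q u z * ?d z) = - \<delta>' u * (\<Sum>z\<in>steps. e u z * ?d z)"
      using sum_step_vel by (simp add: q_eq left_diff_distrib sum_subtractf sum_distrib_left mult.assoc sum_negf)
    moreover have "\<bar>\<Sum>z\<in>steps. e u z * ?d z\<bar> \<le> (\<Sum>z\<in>steps. c z * mean_step z * M * 2)"
    proof (intro order_trans[OF sum_abs] sum_mono)
      fix z assume z: "z \<in> steps"
      show "\<bar>e u z * ?d z\<bar> \<le> c z * mean_step z * M * 2"
        unfolding abs_mult
        by (intro mult_mono abs_e abs_step_vel_le z order_trans[OF abs_ge_zero abs_e[OF z, of u]]) simp
    qed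
    moreover have "(\<Sum>z\<in>steps. c z * mean_step z * M * 2) = M * 2"
      using c_mean by (simp flip: sum_distrib_right)
    ultimately have "\<bar>\<Sum>z\<in>steps. q u z * ?d z\<bar> \<le> \<delta> * (M * 2)"
      using \<delta>'[of u] \<delta> by (auto simp: abs_mult intro!: mult_mono)
    then show ?thesis using \<delta> by (simp add: mult_ac)
  qed
  define h where "h j a = (1 - \<delta> * V) ^ j + (1 + 6 * \<eta>\<^sup>2) ^ j * cosh (\<eta> * a) / cosh (\<eta> * L)" for j a
  have super: "(\<Sum>y\<in>reach x n. pass q x n y * h (m - n) (pos y)) \<le> h m 0" if "n \<le> m" for n
    using that
  proof (induction n)
    case 0
    then show ?case by (simp add: pos_def)
  next
    case (Suc n)
    have "(\<Sum>y\<in>reach x (Suc n). pass q x (Suc n) y * h (m - Suc n) (pos y)) =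
        (\<Sum>y\<in>reach x n. pass q x n y * (\<Sum>z\<in>steps. q y z * h (m - Suc n) (pos (y + z))))"
      by (rule sum_pass_Suc)
    also have "\<dots> \<le> (\<Sum>y\<in>reach x n. pass q x n y * h (m - n) (pos y))"
    proof (intro sum_mono mult_left_mono pass_nonneg q_nonneg)
      fix y
      have pos_add: "pos (y + z) = pos y + ?d z" if "z \<in> steps" for z
        using that by (auto simp: pos_def steps_def algebra_simps)
      have "m - n = Suc (m - Suc n)" using Suc.prems by simp
      then show "(\<Sum>z\<in>steps. q y z * h (m - Suc n) (pos (y + z))) \<le> h (m - n) (pos y)"
        using tube_supersolution_step[OF q_nonneg mass drift abs_step_vel_le \<eta> _ \<delta>(3) L, where j = "m - Suc n"]
          \<delta> V_nonneg by (simp add: pos_add h_def)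
    qed
    also have "\<dots> \<le> h m 0" using Suc by simp
    finally show ?case .
  qed
  have E_tilted: "expectation (\<lambda>\<omega>. ?W \<omega> * g \<omega>) \<le> h m 0"
  proof -
    have "expectation (\<lambda>\<omega>. ?W \<omega> * g \<omega>) = (\<Sum>y\<in>reach x m. expectation (\<lambda>\<omega>. Z x m y \<omega> * g \<omega>))"
      by (simp add: sum_distrib_right Bochner_Integration.integral_sum
        local_fun_integrable[OF local_fun_mult[OF loc_Z loc_g]])
    also have "\<dots> = (\<Sum>y\<in>reach x m. pass q x m y)"
      unfolding g_def q_def[abs_def] by (intro sum.cong refl expectation_pass_prod loc E\<gamma>)
    also have "\<dots> \<le> (\<Sum>y\<in>reach x m. pass q x m y * h (m - m) (pos y))"
    proof (rule sum_mono)
      show "pass q x m y \<le> pass q x m y * h (m - m) (pos y)" for y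
        using mult_left_mono[of 1 "h (m - m) (pos y)" "pass q x m y"] pass_nonneg[of q x m y] q_nonneg
        by (simp add: h_def)
    qed
    also have "\<dots> \<le> h m 0" by (rule super) simp
    finally show ?thesis .
  qed
  define G where "G = (\<lambda>\<omega>. 1 / g \<omega>)"
  have int_G: "integrable P G"
    unfolding G_def by (rule local_fun_integrable[OF loc_g'])
  have int_Wg: "integrable P (\<lambda>\<omega>. ?W \<omega> * g \<omega>)"
    by (rule local_fun_integrable[OF local_fun_mult[OF loc_W loc_g]])
  have "expectation (\<lambda>\<omega>. sqrt (?W \<omega>)) \<le> expectation (\<lambda>\<omega>. (t * (?W \<omega> * g \<omega>) + G \<omega> / t) / 2)"
  proof (rule integral_mono)
    show "integrable P (\<lambda>\<omega>. sqrt (?W \<omega>))"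
      by (rule local_fun_integrable[OF local_fun_sqrt[OF loc_W]])
    show "integrable P (\<lambda>\<omega>. (t * (?W \<omega> * g \<omega>) + G \<omega> / t) / 2)"
      using int_Wg int_G by simp
    fix \<omega> assume "\<omega> \<in> space P"
    then have \<omega>: "\<omega> \<in> space env_space" by (simp add: space_P)
    have "0 \<le> ?W \<omega>" by (intro sum_nonneg Z_nonneg \<omega>)
    then have "sqrt ((t * (?W \<omega> * g \<omega>)) * (G \<omega> / t)) \<le> (t * (?W \<omega> * g \<omega>) + G \<omega> / t) / 2"
      using g_pos[OF \<omega>] t by (intro arith_geo_mean_sqrt) (auto simp: G_def)
    then show "sqrt (?W \<omega>) \<le> (t * (?W \<omega> * g \<omega>) + G \<omega> / t) / 2"
      using g_pos[OF \<omega>] t by (simp add: G_def)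
  qed
  also have "\<dots> = (t * expectation (\<lambda>\<omega>. ?W \<omega> * g \<omega>) + expectation G / t) / 2"
    using int_Wg int_G by simp
  also have "\<dots> \<le> (t * h m 0 + exp (2 * V * \<delta>\<^sup>2 * (real m * (2 * L + 1))) / t) / 2"
    using E_tilted E_inv[folded G_def] t by (intro divide_right_mono add_mono mult_left_mono) auto
  finally show ?thesis by (simp add: h_def)
qed

text \<open>With \<open>m = k ^ 8\<close> and \<open>L = k ^ 6\<close> the tube has of order \<open>k ^ 14\<close> sites, so that a tilt of strength
  \<open>\<delta> = k ^ (-7)\<close> costs a bounded factor but gains \<open>exp (- V * \<delta> * m) = exp (- V * k)\<close>, which beats the
  number \<open>2 * m + 1\<close> of endpoints.\<close>
lemma fractional_moment_contraction:
  assumes V: "0 < V"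
  shows "\<exists>m\<ge>1. \<exists>\<rho><1. \<forall>x. (\<Sum>y\<in>reach x m. expectation (\<lambda>\<omega>. sqrt (Z x m y \<omega>))) \<le> \<rho>"
proof -
  define a where "a = V / 2"
  have a: "0 < a" using V by (simp add: a_def)
  define bd where "bd k = ((2 * real k ^ 8 + 1) * exp (- (a * real k)) +
    2 * ((2 * real k ^ 8 + 1) * exp (a * real k - real k ^ 4 / 24)) +
    (2 * real k ^ 8 + 1) * exp (12 * a - a * real k)) / 2" for k :: nat
  have "(\<lambda>k. (2 * real k ^ 8 + 1) * exp (- (a * real k))) \<longlonglongrightarrow> 0"
    using a by real_asymp
  moreover have "(\<lambda>k. 2 * ((2 * real k ^ 8 + 1) * exp (a * real k - real k ^ 4 / 24))) \<longlonglongrightarrow> 0"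
    using a by real_asymp
  moreover have "(\<lambda>k. (2 * real k ^ 8 + 1) * exp (12 * a - a * real k)) \<longlonglongrightarrow> 0"
    using a by real_asymp
  ultimately have "bd \<longlonglongrightarrow> 0"
    unfolding bd_def[abs_def] by (intro tendsto_divide_zero tendsto_add_zero)
  then have ev_bd: "\<forall>\<^sub>F k in sequentially. bd k < 1 / 2"
    by (rule order_tendstoD) simp
  have "\<forall>\<^sub>F k in sequentially. 2 * (1 / real k ^ 7) * C \<le> 1 / (12 * real k ^ 2)" if "0 < C" for C :: real
    using that by real_asymp
  from this[of M] have ev1: "\<forall>\<^sub>F k in sequentially. 2 * (1 / real k ^ 7) * M \<le> 1 / (12 * real k ^ 2)"
    using M_ge_1 by simp
  have "\<forall>\<^sub>F k in sequentially. (1 / real k ^ 7) * C \<le> (1 / (12 * real k ^ 2))\<^sup>2" if "0 < C" for C :: real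
    using that by real_asymp
  note ev2 = this[OF V]
  obtain k where k: "bd k < 1 / 2" "2 * (1 / real k ^ 7) * M \<le> 1 / (12 * real k ^ 2)"
    "(1 / real k ^ 7) * V \<le> (1 / (12 * real k ^ 2))\<^sup>2" "1 \<le> k"
    using eventually_happens[OF eventually_conj[OF ev_bd eventually_conj[OF ev1 eventually_conj[OF ev2 eventually_ge_at_top[of 1]]]]]
    by auto
  define m where "m = k ^ 8"
  define \<eta> where "\<eta> = 1 / (12 * real k ^ 2)"
  define \<delta> where "\<delta> = 1 / real k ^ 7"
  define L where "L = real k ^ 6"
  define t where "t = exp (V * k / 2)"
  have k1: "1 \<le> real k" using k(4) by simp
  then have "0 < k" by linarith
  have "1 \<le> real k ^ 2" using k1 by (rule one_le_power)
  then have "1 / (12 * real k ^ 2) \<le> 1 / 12" using \<open>0 < k\<close> by (simp add: field_simps)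
  then have "\<eta> \<le> 1 / 2" unfolding \<eta>_def by linarith
  have "0 < \<eta>" using \<open>0 < k\<close> by (simp add: \<eta>_def)
  note \<eta> = this \<open>\<eta> \<le> 1 / 2\<close>
  have \<delta>: "0 \<le> \<delta>" by (simp add: \<delta>_def)
  have \<delta>1: "\<delta> * V \<le> 1"
  proof -
    have "\<eta>\<^sup>2 \<le> 1" using \<eta> by (intro power_le_one) auto
    then show ?thesis using k(3) by (simp add: \<delta>_def \<eta>_def)
  qed
  have m_eq: "real m = real k ^ 8" by (simp add: m_def)
  have pow1: "(1 - \<delta> * V) ^ m \<le> exp (- (V * k))"
  proof -
    have "(1 - \<delta> * V) ^ m \<le> exp (- (\<delta> * V)) ^ m"
      using \<delta>1 exp_ge_add_one_self[of "- (\<delta> * V)"] by (intro power_mono) auto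
    also have "\<dots> = exp (real m * (- (\<delta> * V)))" by (rule exp_of_nat_mult[symmetric])
    also have "real m * (- (\<delta> * V)) = - (V * k)"
      using k1 by (simp add: m_eq \<delta>_def field_simps power_numeral_reduce)
    finally show ?thesis .
  qed
  have pow2: "(1 + 6 * \<eta>\<^sup>2) ^ m \<le> exp (real k ^ 4 / 24)"
  proof -
    have "(1 + 6 * \<eta>\<^sup>2) ^ m \<le> exp (6 * \<eta>\<^sup>2) ^ m"
      using exp_ge_add_one_self[of "6 * \<eta>\<^sup>2"] by (intro power_mono) auto
    also have "\<dots> = exp (real m * (6 * \<eta>\<^sup>2))" by (rule exp_of_nat_mult[symmetric])
    also have "real m * (6 * \<eta>\<^sup>2) = real k ^ 4 / 24"
      using k1 by (simp add: m_eq \<eta>_def field_simps power_numeral_reduce)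
    finally show ?thesis .
  qed
  have \<eta>L: "\<eta> * L = real k ^ 4 / 12"
    using k1 by (simp add: \<eta>_def L_def field_simps power_numeral_reduce)
  have cosh_ge: "exp (real k ^ 4 / 12) / 2 \<le> cosh (\<eta> * L)"
    unfolding \<eta>L by (simp add: cosh_field_def)
  have ratio: "(1 + 6 * \<eta>\<^sup>2) ^ m / cosh (\<eta> * L) \<le> 2 * exp (- (real k ^ 4 / 24))"
  proof -
    have "(1 + 6 * \<eta>\<^sup>2) ^ m / cosh (\<eta> * L) \<le> exp (real k ^ 4 / 24) / (exp (real k ^ 4 / 12) / 2)"
      by (rule frac_le[OF _ pow2 _ cosh_ge]) auto
    also have "\<dots> = 2 * exp (real k ^ 4 / 24 - real k ^ 4 / 12)"
      unfolding exp_diff by simp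
    also have "real k ^ 4 / 24 - real k ^ 4 / 12 = - (real k ^ 4 / 24)" by simp
    finally show ?thesis .
  qed
  have expo: "2 * V * \<delta>\<^sup>2 * (real m * (2 * L + 1)) \<le> 6 * V"
  proof -
    have "\<delta>\<^sup>2 * (real m * (2 * L + 1)) = 2 + 1 / real k ^ 6"
      using k1 by (simp add: m_eq \<delta>_def L_def field_simps power_numeral_reduce)
    also have "\<dots> \<le> 3" using one_le_power[OF k1, of 6] \<open>0 < k\<close> by (simp add: divide_le_eq)
    finally have "2 * V * (\<delta>\<^sup>2 * (real m * (2 * L + 1))) \<le> 2 * V * 3"
      using V by (intro mult_left_mono) auto
    then show ?thesis by (simp add: mult.assoc)
  qed
  have tot: "expectation (\<lambda>\<omega>. sqrt (\<Sum>y\<in>reach x m. Z x m y \<omega>)) \<le>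
    (exp (- (a * k)) + 2 * exp (a * k - real k ^ 4 / 24) + exp (12 * a - a * k)) / 2" for x
  proof -
    have "expectation (\<lambda>\<omega>. sqrt (\<Sum>y\<in>reach x m. Z x m y \<omega>)) \<le>
      (t * ((1 - \<delta> * V) ^ m + (1 + 6 * \<eta>\<^sup>2) ^ m / cosh (\<eta> * L)) +
       exp (2 * V * \<delta>\<^sup>2 * (real m * (2 * L + 1))) / t) / 2"
      using k \<eta> \<delta> by (intro sqrt_total_le) (auto simp: \<eta>_def \<delta>_def L_def t_def)
    also have "\<dots> \<le> (t * (exp (- (V * k)) + 2 * exp (- (real k ^ 4 / 24))) + exp (6 * V) / t) / 2"
      using pow1 ratio expo by (intro divide_right_mono add_mono mult_left_mono) (auto simp: t_def)
    also have "\<dots> = (exp (- (a * k)) + 2 * exp (a * k - real k ^ 4 / 24) + exp (12 * a - a * k)) / 2"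
      by (simp add: t_def a_def distrib_left exp_diff exp_minus field_simps exp_add[symmetric])
    finally show ?thesis .
  qed
  have "(\<Sum>y\<in>reach x m. expectation (\<lambda>\<omega>. sqrt (Z x m y \<omega>))) \<le> 1 / 2" for x
  proof -
    have loc: "local_fun UNIV (\<lambda>\<omega>. Z x m y \<omega>)" for y
      by (rule local_fun_mono[OF local_fun_pass]) simp
    have "(\<Sum>y\<in>reach x m. expectation (\<lambda>\<omega>. sqrt (Z x m y \<omega>))) \<le>
        (\<Sum>y\<in>reach x m. expectation (\<lambda>\<omega>. sqrt (\<Sum>y\<in>reach x m. Z x m y \<omega>)))"
    proof (intro sum_mono integral_mono local_fun_integrable[OF local_fun_sqrt] loc local_fun_sum)
      show "sqrt (Z x m y \<omega>) \<le> sqrt (\<Sum>y\<in>reach x m. Z x m y \<omega>)"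
        if "y \<in> reach x m" "\<omega> \<in> space P" for y \<omega>
        using that by (intro real_sqrt_le_mono member_le_sum Z_nonneg) (auto simp: space_P)
    qed (rule loc finite_reach)+
    also have "\<dots> = (2 * real k ^ 8 + 1) * expectation (\<lambda>\<omega>. sqrt (\<Sum>y\<in>reach x m. Z x m y \<omega>))"
      by (simp add: card_reach m_eq)
    also have "\<dots> \<le> (2 * real k ^ 8 + 1) *
        ((exp (- (a * k)) + 2 * exp (a * k - real k ^ 4 / 24) + exp (12 * a - a * k)) / 2)"
      by (intro mult_left_mono tot) simp
    also have "\<dots> = bd k" by (simp add: bd_def algebra_simps)
    finally show ?thesis using k(1) by simp
  qed
  moreover have "1 \<le> m" using k(4) by (simp add: m_def)
  ultimately show ?thesis by (intro exI[of _ m] conjI exI[of _ "1 / 2"]) auto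
qed

end

subsection \<open>Bounds on the rate functions\<close>

lemma sqrt_sum_le: "finite S \<Longrightarrow> (\<And>i. i \<in> S \<Longrightarrow> 0 \<le> f i) \<Longrightarrow> sqrt (\<Sum>i\<in>S. f i) \<le> (\<Sum>i\<in>S. sqrt (f i))"
proof (induction S rule: finite_induct)
  case (insert i S)
  have "sqrt (f i + (\<Sum>i\<in>S. f i)) \<le> sqrt (f i) + sqrt (\<Sum>i\<in>S. f i)"
    using insert by (intro sqrt_add_le_add_sqrt sum_nonneg) auto
  with insert show ?case by simp
qed simp

lemma ln_ereal_le:
  assumes "0 \<le> p" "p \<le> exp (real N * b)" "1 \<le> N"
  shows "ereal (1 / real N) * ln_ereal p \<le> ereal b"
proof (cases "p = 0")
  case False
  then have "ln p \<le> ln (exp (real N * b))" using assms by (subst ln_le_cancel_iff) auto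
  then show ?thesis using False assms(3) by (simp add: ln_ereal_def divide_le_eq mult.commute)
qed (use assms(3) in \<open>simp add: ln_ereal_def\<close>)

lemma ln_ereal_ge:
  assumes "exp (real N * b) \<le> p" "1 \<le> N"
  shows "ereal b \<le> ereal (1 / real N) * ln_ereal p"
proof -
  have p: "0 < p" using assms(1) less_le_trans[OF exp_gt_zero] by blast
  then have "ln (exp (real N * b)) \<le> ln p" using assms by (subst ln_le_cancel_iff) auto
  then show ?thesis using p assms(2) by (simp add: ln_ereal_def le_divide_eq mult.commute)
qed

lemma LDP_closed:
  assumes LDP: "satisfies_LDP Q I" and F: "closed F"
    and b: "ereal b \<le> limsup (\<lambda>n. ereal (1 / real n) * ln_ereal (measure (Q n) F))"
  shows "(INF x\<in>F. I x) \<le> ereal (- b)"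
proof -
  have "F \<in> sets borel" using F by (rule borel_closed)
  then have "limsup (\<lambda>n. ereal (1 / real n) * ln_ereal (measure (Q n) F)) \<le> - (INF x\<in>closure F. I x)"
    using LDP unfolding satisfies_LDP_def by blast
  then have "ereal b \<le> - (INF x\<in>F. I x)" using b F by (simp add: closure_closed)
  then have "- (- (INF x\<in>F. I x)) \<le> - ereal b" by (simp only: ereal_minus_le_minus)
  then show ?thesis by simp
qed

lemma LDP_open:
  assumes LDP: "satisfies_LDP Q I" and G: "open G"
    and b: "liminf (\<lambda>n. ereal (1 / real n) * ln_ereal (measure (Q n) G)) \<le> ereal b"
  shows "ereal (- b) \<le> (INF x\<in>G. I x)"
proof -
  have "G \<in> sets borel" using G by (rule borel_open)
  then have "- (INF x\<in>interior G. I x) \<le> liminf (\<lambda>n. ereal (1 / real n) * ln_ereal (measure (Q n) G))"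
    using LDP unfolding satisfies_LDP_def by blast
  then have "- (INF x\<in>G. I x) \<le> ereal b" using b G by (simp add: interior_open)
  then have "- ereal b \<le> - (- (INF x\<in>G. I x))" by (simp only: ereal_minus_le_minus)
  then show ?thesis by simp
qed

lemma rate_le_if_nearby:
  fixes I :: "'a::real_normed_vector \<Rightarrow> ereal"
  assumes I: "convex_rate_function I" and near: "\<And>r. 0 < r \<Longrightarrow> (INF x\<in>cball \<xi> r. I x) \<le> ereal (K + B * r)"
  shows "I \<xi> \<le> ereal K"
proof (rule ccontr)
  assume "\<not> I \<xi> \<le> ereal K"
  then have "ereal K < I \<xi>" by simp
  then obtain K' :: real where K': "K < K'" "ereal K' < I \<xi>"
    by (metis ereal_dense2 ereal_less_eq(3) less_ereal.simps(1))
  have "closed {x. I x \<le> ereal K'}" using I by (simp add: convex_rate_function_def)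
  then have "open (- {x. I x \<le> ereal K'})" by (simp add: open_Compl)
  then obtain e where e: "0 < e" "ball \<xi> e \<subseteq> - {x. I x \<le> ereal K'}"
    using K'(2) by (metis (mono_tags, lifting) ComplI leD mem_Collect_eq open_contains_ball)
  define r where "r = min (e / 2) ((K' - K) / (2 * (\<bar>B\<bar> + 1)))"
  have r: "0 < r" "r < e" using e K' by (auto simp: r_def)
  have "B * r \<le> (\<bar>B\<bar> + 1) * ((K' - K) / (2 * (\<bar>B\<bar> + 1)))"
    using r K' by (intro mult_mono) (auto simp: r_def)
  also have "\<dots> = (K' - K) / 2" by (simp add: field_simps)
  finally have "K + B * r < K'" using K' by simp
  moreover have "ereal K' \<le> (INF x\<in>cball \<xi> r. I x)"
  proof (rule INF_greatest)
    fix x assume "x \<in> cball \<xi> r"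
    then have "x \<in> ball \<xi> e" using r by simp
    then have "\<not> I x \<le> ereal K'" using e(2) by blast
    then show "ereal K' \<le> I x" by simp
  qed
  ultimately show False using near[OF r(1)]
    by (metis ereal_less_eq(3) leD order_trans)
qed

context weighted_iid_env
begin

lemma local_Z: "local_fun UNIV (Z x n y)"
  by (rule local_fun_mono[OF local_fun_pass]) simp

lemma integrable_sqrt_Z: "integrable P (\<lambda>\<omega>. sqrt (Z x n y \<omega>))"
  by (rule local_fun_integrable[OF local_fun_sqrt[OF local_Z]])

lemma half_moment_power:
  assumes \<rho>: "\<And>x. (\<Sum>y\<in>reach x m. expectation (\<lambda>\<omega>. sqrt (Z x m y \<omega>))) \<le> \<rho>"
  shows "(\<Sum>y\<in>reach x (n * m). expectation (\<lambda>\<omega>. sqrt (Z x (n * m) y \<omega>))) \<le> \<rho> ^ n"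
proof (induction n)
  case 0
  then show ?case by (simp add: prob_space)
next
  case (Suc n)
  let ?N = "n * m"
  have E_nonneg: "0 \<le> expectation (\<lambda>\<omega>. sqrt (Z x n y \<omega>))" for x n y
    using Z_nonneg by (intro integral_nonneg_AE AE_I2) (simp add: space_P)
  have "0 \<le> \<rho>" by (rule order_trans[OF _ \<rho>[of x]]) (intro sum_nonneg E_nonneg)
  have indep: "expectation (\<lambda>\<omega>. sqrt (Z x ?N u \<omega>) * sqrt (Z u m y \<omega>)) =
      expectation (\<lambda>\<omega>. sqrt (Z x ?N u \<omega>)) * expectation (\<lambda>\<omega>. sqrt (Z u m y \<omega>))"
    if "u \<in> reach x ?N" for u y
    using that by (intro expectation_mult[OF local_fun_sqrt[OF local_fun_pass] local_fun_sqrt[OF local_fun_pass]])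
      (auto simp: slab_def mem_reach)
  have int2: "integrable P (\<lambda>\<omega>. sqrt (Z x ?N u \<omega>) * sqrt (Z u m y \<omega>))" for u y
    by (rule local_fun_integrable[OF local_fun_mult[OF local_fun_sqrt[OF local_Z] local_fun_sqrt[OF local_Z]]])
  have "(\<Sum>y\<in>reach x (?N + m). expectation (\<lambda>\<omega>. sqrt (Z x (?N + m) y \<omega>))) \<le>
      (\<Sum>y\<in>reach x (?N + m). expectation (\<lambda>\<omega>. \<Sum>u\<in>reach x ?N. sqrt (Z x ?N u \<omega>) * sqrt (Z u m y \<omega>)))"
  proof (intro sum_mono integral_mono)
    show "integrable P (\<lambda>\<omega>. sqrt (Z x (?N + m) y \<omega>))"
      "integrable P (\<lambda>\<omega>. \<Sum>u\<in>reach x ?N. sqrt (Z x ?N u \<omega>) * sqrt (Z u m y \<omega>))" for y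
      by (intro integrable_sqrt_Z Bochner_Integration.integrable_sum int2)+
    fix y \<omega> assume "\<omega> \<in> space P"
    then have \<omega>: "\<omega> \<in> space env_space" by (simp add: space_P)
    show "sqrt (Z x (?N + m) y \<omega>) \<le> (\<Sum>u\<in>reach x ?N. sqrt (Z x ?N u \<omega>) * sqrt (Z u m y \<omega>))"
      unfolding pass_add real_sqrt_mult[symmetric]
      by (intro sqrt_sum_le finite_reach mult_nonneg_nonneg Z_nonneg \<omega>)
  qed
  also have "\<dots> = (\<Sum>y\<in>reach x (?N + m). \<Sum>u\<in>reach x ?N.
      expectation (\<lambda>\<omega>. sqrt (Z x ?N u \<omega>)) * expectation (\<lambda>\<omega>. sqrt (Z u m y \<omega>)))"
    using int2 indep by (simp add: Bochner_Integration.integral_sum)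
  also have "\<dots> = (\<Sum>u\<in>reach x ?N. expectation (\<lambda>\<omega>. sqrt (Z x ?N u \<omega>)) *
      (\<Sum>y\<in>reach x (?N + m). expectation (\<lambda>\<omega>. sqrt (Z u m y \<omega>))))"
    by (subst sum.swap) (simp add: sum_distrib_left)
  also have "\<dots> = (\<Sum>u\<in>reach x ?N. expectation (\<lambda>\<omega>. sqrt (Z x ?N u \<omega>)) *
      (\<Sum>y\<in>reach u m. expectation (\<lambda>\<omega>. sqrt (Z u m y \<omega>))))"
  proof (rule sum.cong)
    fix u assume "u \<in> reach x ?N"
    then have "reach u m \<subseteq> reach x (?N + m)" by (auto simp: mem_reach)
    then have "(\<Sum>y\<in>reach x (?N + m). expectation (\<lambda>\<omega>. sqrt (Z u m y \<omega>))) =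
        (\<Sum>y\<in>reach u m. expectation (\<lambda>\<omega>. sqrt (Z u m y \<omega>)))"
      by (intro sum.mono_neutral_right) (auto simp: pass_eq_0)
    then show "expectation (\<lambda>\<omega>. sqrt (Z x ?N u \<omega>)) * (\<Sum>y\<in>reach x (?N + m). expectation (\<lambda>\<omega>. sqrt (Z u m y \<omega>))) =
        expectation (\<lambda>\<omega>. sqrt (Z x ?N u \<omega>)) * (\<Sum>y\<in>reach u m. expectation (\<lambda>\<omega>. sqrt (Z u m y \<omega>)))"
      by simp
  qed simp
  also have "\<dots> \<le> (\<Sum>u\<in>reach x ?N. expectation (\<lambda>\<omega>. sqrt (Z x ?N u \<omega>)) * \<rho>)"
    by (intro sum_mono mult_left_mono \<rho> E_nonneg)
  also have "\<dots> \<le> \<rho> ^ n * \<rho>"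
    using Suc \<open>0 \<le> \<rho>\<close> by (simp add: mult_right_mono flip: sum_distrib_right)
  finally show ?case by (simp add: add.commute mult.commute)
qed

lemma AE_partition_bound:
  assumes \<rho>: "\<And>x. (\<Sum>y\<in>reach x m. expectation (\<lambda>\<omega>. sqrt (Z x m y \<omega>))) \<le> \<rho>"
    and \<rho>': "\<rho> < \<rho>'" "0 < \<rho>'"
  shows "AE \<omega> in P. \<forall>\<^sub>F n in sequentially. (\<Sum>y\<in>reach x (n * m). Z x (n * m) y \<omega>) \<le> (\<rho>' ^ n)\<^sup>2"
proof -
  let ?W = "\<lambda>n \<omega>. \<Sum>y\<in>reach x (n * m). Z x (n * m) y \<omega>"
  define A where "A n = {\<omega> \<in> space P. \<rho>' ^ n \<le> sqrt (?W n \<omega>)}" for n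
  have W_nonneg: "0 \<le> ?W n \<omega>" if "\<omega> \<in> space P" for n \<omega>
    using that by (intro sum_nonneg Z_nonneg) (simp add: space_P)
  have loc: "local_fun UNIV (\<lambda>\<omega>. sqrt (?W n \<omega>))" for n
    by (intro local_fun_sqrt local_fun_sum local_Z) simp
  note int = local_fun_integrable[OF loc]
  have "0 \<le> \<rho>"
    using Z_nonneg by (intro order_trans[OF _ \<rho>[of x]] sum_nonneg integral_nonneg_AE AE_I2) (simp add: space_P)
  have E: "expectation (\<lambda>\<omega>. sqrt (?W n \<omega>)) \<le> \<rho> ^ n" for n
  proof -
    have "expectation (\<lambda>\<omega>. sqrt (?W n \<omega>)) \<le>
        expectation (\<lambda>\<omega>. \<Sum>y\<in>reach x (n * m). sqrt (Z x (n * m) y \<omega>))"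
      using int integrable_sqrt_Z
      by (intro integral_mono Bochner_Integration.integrable_sum sqrt_sum_le Z_nonneg) (auto simp: space_P)
    also have "\<dots> = (\<Sum>y\<in>reach x (n * m). expectation (\<lambda>\<omega>. sqrt (Z x (n * m) y \<omega>)))"
      using integrable_sqrt_Z by (intro Bochner_Integration.integral_sum)
    also have "\<dots> \<le> \<rho> ^ n" by (rule half_moment_power[OF \<rho>])
    finally show ?thesis .
  qed
  have A_sets: "A n \<in> events" for n
    unfolding A_def using borel_measurable_integrable[OF int[of n]] by measurable
  have A_prob: "prob (A n) \<le> (\<rho> / \<rho>') ^ n" for n
  proof -
    have "prob (A n) \<le> expectation (\<lambda>\<omega>. sqrt (?W n \<omega>)) / \<rho>' ^ n"
      unfolding A_def using W_nonneg \<rho>'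
      by (intro integral_Markov_inequality_measure[OF int sets.top]) auto
    also have "\<dots> \<le> \<rho> ^ n / \<rho>' ^ n" using E \<rho>' by (intro divide_right_mono) auto
    finally show ?thesis by (simp add: power_divide)
  qed
  have "summable (\<lambda>n. (\<rho> / \<rho>') ^ n)"
    using \<rho>' \<open>0 \<le> \<rho>\<close> by (intro summable_geometric) (simp add: divide_less_eq)
  then have "summable (\<lambda>n. prob (A n))"
    by (rule summable_comparison_test') (use A_prob in auto)
  then have "AE \<omega> in P. \<forall>\<^sub>F n in sequentially. \<omega> \<in> space P - A n"
    by (intro borel_cantelli_AE1 A_sets) (auto simp: emeasure_eq_measure)
  then show ?thesis
  proof (rule AE_mp, intro AE_I2 impI)
    fix \<omega> assume \<omega>: "\<omega> \<in> space P" and ev: "\<forall>\<^sub>F n in sequentially. \<omega> \<in> space P - A n"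
    from ev show "\<forall>\<^sub>F n in sequentially. ?W n \<omega> \<le> (\<rho>' ^ n)\<^sup>2"
    proof eventually_elim
      case (elim n)
      then have "sqrt (?W n \<omega>) \<le> \<rho>' ^ n" using \<omega> by (auto simp: A_def)
      then show ?case using W_nonneg[OF \<omega>, of n] by (simp add: sqrt_le_D)
    qed
  qed
qed

end

context iid_env
begin

definition mgf :: "real \<Rightarrow> real" where
  "mgf \<theta> = (\<Sum>z\<in>steps. exp (\<theta> * of_int (fst z)) * mean_step z)"

definition tilt :: "real \<Rightarrow> site \<Rightarrow> real" where
  "tilt \<theta> z = 1 / mgf \<theta> * exp (\<theta> * of_int (fst z))"

lemma sum_mean_step: "(\<Sum>z\<in>steps. mean_step z) = 1"
proof -
  have "(\<Sum>z\<in>steps. mean_step z) = expectation (\<lambda>\<omega>. \<Sum>z\<in>steps. \<omega> 0 z)"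
    using local_fun_integrable[OF local_fun_env[OF _ UNIV_I]] by (intro Bochner_Integration.integral_sum[symmetric]) auto
  also have "\<dots> = expectation (\<lambda>_. 1)"
    by (intro Bochner_Integration.integral_cong) (simp_all add: env_sum space_P)
  finally show ?thesis by (simp add: prob_space)
qed

lemma mgf_pos: "0 < mgf \<theta>"
proof -
  have "exp (- \<bar>\<theta>\<bar>) = (\<Sum>z\<in>steps. exp (- \<bar>\<theta>\<bar>) * mean_step z)"
    by (simp add: sum_mean_step flip: sum_distrib_left)
  also have "\<dots> \<le> mgf \<theta>"
    unfolding mgf_def by (intro sum_mono mult_right_mono mean_step_nonneg) (auto simp: steps_def)
  finally show ?thesis using less_le_trans[OF exp_gt_zero] by blast
qed

end

locale tilted_iid_env = iid_env +
  fixes \<theta> :: real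
begin

sublocale weighted_iid_env P "tilt \<theta>"
proof
  show "0 \<le> tilt \<theta> z" for z using mgf_pos[of \<theta>] by (simp add: tilt_def)
  have "(\<Sum>z\<in>steps. tilt \<theta> z * mean_step z) = 1 / mgf \<theta> * mgf \<theta>"
    by (simp add: tilt_def mgf_def sum_distrib_left mult.assoc)
  then show "(\<Sum>z\<in>steps. tilt \<theta> z * mean_step z) = 1" using mgf_pos[of \<theta>] by simp
qed

lemma pass_eq_tilted:
  "pass K 0 n y = mgf \<theta> ^ n * exp (- \<theta> * of_int (fst y)) * pass (\<lambda>u z. tilt \<theta> z * K u z) 0 n y"
  unfolding tilt_def pass_tilt using mgf_pos[of \<theta>]
  by (simp add: power_divide exp_minus field_simps)

text \<open>Upper bound on quenched probabilities near \<open>(v, 1)\<close>: the exponential Chebyshev inequality along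
  the times \<open>n * m\<close>, at which the tilted partition function is controlled.\<close>
lemma quenched_rate_ge:
  assumes Iq: "quenched_rate_function P I" and m: "1 \<le> m"
    and \<rho>: "\<And>x. (\<Sum>y\<in>reach x m. expectation (\<lambda>\<omega>. sqrt (Z x m y \<omega>))) \<le> \<rho>"
    and \<rho>': "\<rho> < \<rho>'" "0 < \<rho>'"
  shows "ereal (\<theta> * v - ln (mgf \<theta>) - 2 / real m * ln \<rho>') \<le> I (v, 1)"
proof -
  let ?W = "\<lambda>n \<omega>. \<Sum>y\<in>reach 0 (n * m). Z 0 (n * m) y \<omega>"
  let ?Q = "\<lambda>\<omega> n. distr (quenched_law \<omega> 0) borel (empirical_velocity n)"
  have "AE \<omega> in P. satisfies_LDP (?Q \<omega>) I \<and> (\<forall>\<^sub>F n in sequentially. ?W n \<omega> \<le> (\<rho>' ^ n)\<^sup>2) \<and> \<omega> \<in> space P"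
    using Iq AE_partition_bound[OF \<rho> \<rho>', of 0] AE_space by (auto simp: quenched_rate_function_def)
  then obtain \<omega> where LDP: "satisfies_LDP (?Q \<omega>) I" and W: "\<forall>\<^sub>F n in sequentially. ?W n \<omega> \<le> (\<rho>' ^ n)\<^sup>2"
    and \<omega>: "\<omega> \<in> space env_space"
    unfolding space_P[symmetric] using eventually_happens'[OF ae_filter_bot] by blast
  have near: "ereal (\<theta> * v - ln (mgf \<theta>) - 2 / real m * ln \<rho>') \<le> I (v, 1) + ereal (\<bar>\<theta>\<bar> * r)" if r: "0 < r" for r
  proof -
    let ?G = "ball (v, 1 :: real) r"
    define b where "b = ln (mgf \<theta>) - \<theta> * v + \<bar>\<theta>\<bar> * r + 2 / real m * ln \<rho>'"
    have bound: "ereal (1 / real (n * m)) * ln_ereal (measure (?Q \<omega> (n * m)) ?G) \<le> ereal b"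
      if n: "1 \<le> n" "?W n \<omega> \<le> (\<rho>' ^ n)\<^sup>2" for n
    proof (rule ln_ereal_le)
      let ?N = "n * m"
      show N: "1 \<le> ?N" using n m by simp
      let ?T = "{y \<in> reach 0 ?N. (1 / real ?N) *\<^sub>R real_site y \<in> ?G}"
      let ?c = "mgf \<theta> ^ ?N * exp (real ?N * (- \<theta> * v + \<bar>\<theta>\<bar> * r))"
      have "measure (?Q \<omega> ?N) ?G = (\<Sum>y\<in>?T. pass \<omega> 0 ?N y)"
        by (rule measure_quenched_velocity[OF \<omega>]) simp
      also have "\<dots> \<le> (\<Sum>y\<in>?T. ?c * Z 0 ?N y \<omega>)"
      proof (rule sum_mono)
        fix y assume y: "y \<in> ?T"
        have "dist (fst (v, 1 :: real)) (fst ((1 / real ?N) *\<^sub>R real_site y)) < r"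
          using y by (intro le_less_trans[OF dist_fst_le]) simp
        then have "\<bar>v - of_int (fst y) / real ?N\<bar> \<le> r"
          by (simp add: real_site_def dist_real_def)
        then have "\<theta> * (v - of_int (fst y) / real ?N) \<le> \<bar>\<theta>\<bar> * r"
          by (metis abs_ge_self abs_ge_zero abs_mult mult_left_mono order_trans)
        then have "real ?N * (\<theta> * (v - of_int (fst y) / real ?N)) \<le> real ?N * (\<bar>\<theta>\<bar> * r)"
          by (intro mult_left_mono) auto
        moreover have "real ?N * (\<theta> * (v - of_int (fst y) / real ?N)) = real ?N * (\<theta> * v) - \<theta> * of_int (fst y)"
          using N by (simp add: field_simps)
        ultimately have "- \<theta> * of_int (fst y) \<le> real ?N * (- \<theta> * v + \<bar>\<theta>\<bar> * r)"
          by (simp add: algebra_simps)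
        then show "pass \<omega> 0 ?N y \<le> ?c * Z 0 ?N y \<omega>"
          unfolding pass_eq_tilted[of \<omega>] using mgf_pos[of \<theta>] Z_nonneg[OF \<omega>]
          by (intro mult_right_mono mult_left_mono) auto
      qed
      also have "\<dots> \<le> ?c * ?W n \<omega>"
        unfolding sum_distrib_left[symmetric] using mgf_pos[of \<theta>] Z_nonneg[OF \<omega>]
        by (intro mult_left_mono sum_mono2) auto
      also have "\<dots> \<le> ?c * (\<rho>' ^ n)\<^sup>2"
        using n(2) mgf_pos[of \<theta>] by (intro mult_left_mono) auto
      also have "\<dots> = exp (real ?N * b)"
      proof -
        have "mgf \<theta> ^ ?N = exp (real ?N * ln (mgf \<theta>))"
          using mgf_pos[of \<theta>] by (simp add: exp_of_nat_mult del: of_nat_mult)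
        moreover have "(\<rho>' ^ n)\<^sup>2 = exp (real (n * 2) * ln \<rho>')"
          using \<rho>' by (simp add: exp_of_nat_mult power_mult del: of_nat_mult)
        moreover have "real (n * 2) * ln \<rho>' = real ?N * (2 / real m * ln \<rho>')"
          using m by simp
        ultimately show ?thesis
          unfolding b_def by (simp only: exp_add[symmetric] distrib_left diff_conv_add_uminus) (simp add: algebra_simps)
      qed
      finally show "measure (?Q \<omega> ?N) ?G \<le> exp (real ?N * b)" .
    qed simp
    have "liminf (\<lambda>n. ereal (1 / real n) * ln_ereal (measure (?Q \<omega> n) ?G)) \<le> ereal b"
    proof (rule ccontr)
      assume "\<not> ?thesis"
      then have "\<forall>\<^sub>F n in sequentially. ereal b < ereal (1 / real n) * ln_ereal (measure (?Q \<omega> n) ?G)"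
        by (intro less_LiminfD) simp
      moreover have "filterlim (\<lambda>n. n * m) sequentially sequentially"
        using m by (intro filterlim_subseq strict_monoI) simp
      ultimately have "\<forall>\<^sub>F n in sequentially. ereal b < ereal (1 / real (n * m)) * ln_ereal (measure (?Q \<omega> (n * m)) ?G)"
        by (rule eventually_compose_filterlim)
      with W eventually_ge_at_top[of 1] have "\<forall>\<^sub>F n in sequentially. False"
      proof eventually_elim
        case (elim n)
        from leD[OF bound[OF elim(2,1)]] elim(3) show ?case by blast
      qed
      then show False by simp
    qed
    then have "ereal (- b) \<le> (INF x\<in>?G. I x)"
      by (rule LDP_open[OF LDP open_ball])
    also have "\<dots> \<le> I (v, 1)" using r by (intro INF_lower) simp
    finally have "ereal (- b) + ereal (\<bar>\<theta>\<bar> * r) \<le> I (v, 1) + ereal (\<bar>\<theta>\<bar> * r)"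
      by (rule add_right_mono)
    then show ?thesis by (simp add: b_def algebra_simps)
  qed
  show ?thesis
  proof (rule ereal_le_epsilon2)
    fix e :: real assume e: "0 < e"
    define r where "r = e / (\<bar>\<theta>\<bar> + 1)"
    have "\<bar>\<theta>\<bar> * r \<le> e" using e by (simp add: r_def field_simps)
    moreover have "0 < r" using e by (simp add: r_def)
    ultimately show "ereal (\<theta> * v - ln (mgf \<theta>) - 2 / real m * ln \<rho>') \<le> I (v, 1) + ereal e"
      using near[of r] by (meson add_left_mono ereal_less_eq(3) order_trans)
  qed
qed

abbreviation tilted_mean :: "nat \<Rightarrow> site \<Rightarrow> real" where
  "tilted_mean \<equiv> pass (\<lambda>_ z. tilt \<theta> z * mean_step z) 0"

lemma tilted_mean_nonneg: "0 \<le> tilted_mean n y"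
  by (intro pass_nonneg mult_nonneg_nonneg c_nonneg mean_step_nonneg)

lemma tilted_second_moment:
  "(\<Sum>y\<in>reach 0 n. tilted_mean n y * (of_int (fst y) - real n * vel)\<^sup>2) \<le> 4 * real n"
proof (induction n)
  case (Suc n)
  let ?q = "\<lambda>z. tilt \<theta> z * mean_step z" and ?d = "\<lambda>z. of_int (fst z) - vel"
  have "(\<Sum>z\<in>steps. ?q z * (of_int (fst (y + z)) - real (Suc n) * vel)\<^sup>2) \<le> (of_int (fst y) - real n * vel)\<^sup>2 + 4"
    for y
  proof -
    let ?a = "of_int (fst y) - real n * vel"
    have "(\<Sum>z\<in>steps. ?q z * (of_int (fst (y + z)) - real (Suc n) * vel)\<^sup>2) = (\<Sum>z\<in>steps. ?q z * (?a + ?d z)\<^sup>2)"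
      by (intro sum.cong refl arg_cong[where f = "\<lambda>t. _ * t\<^sup>2"]) (auto simp: algebra_simps steps_def)
    also have "\<dots> = ?a\<^sup>2 * (\<Sum>z\<in>steps. ?q z) + 2 * ?a * (\<Sum>z\<in>steps. ?q z * ?d z) + (\<Sum>z\<in>steps. ?q z * (?d z)\<^sup>2)"
      unfolding sum_steps by (simp add: power2_eq_square algebra_simps)
    also have "\<dots> = ?a\<^sup>2 + (\<Sum>z\<in>steps. ?q z * (?d z)\<^sup>2)"
      using c_mean sum_step_vel by simp
    also have "(\<Sum>z\<in>steps. ?q z * (?d z)\<^sup>2) \<le> (\<Sum>z\<in>steps. ?q z * 4)"
    proof (intro sum_mono mult_left_mono mult_nonneg_nonneg c_nonneg mean_step_nonneg)
      show "(?d z)\<^sup>2 \<le> 4" if "z \<in> steps" for z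
        using abs_step_vel_le[OF that] abs_le_square_iff[of "?d z" 2] by simp
    qed
    also have "(\<Sum>z\<in>steps. ?q z * 4) = 4" using c_mean by (simp flip: sum_distrib_right)
    finally show ?thesis by simp
  qed
  then have "(\<Sum>y\<in>reach 0 (Suc n). tilted_mean (Suc n) y * (of_int (fst y) - real (Suc n) * vel)\<^sup>2) \<le>
      (\<Sum>y\<in>reach 0 n. tilted_mean n y * ((of_int (fst y) - real n * vel)\<^sup>2 + 4))"
    unfolding sum_pass_Suc by (intro sum_mono mult_left_mono tilted_mean_nonneg)
  also have "\<dots> = (\<Sum>y\<in>reach 0 n. tilted_mean n y * (of_int (fst y) - real n * vel)\<^sup>2) + 4"
    using sum_pass_const[of "\<lambda>_ z. tilt \<theta> z * mean_step z" 0 n] c_mean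
    by (simp add: distrib_left sum.distrib flip: sum_distrib_right)
  finally show ?case using Suc by simp
qed simp

lemma tilted_chebyshev:
  assumes r: "0 < r" and N: "1 \<le> N"
  shows "1 - 4 / (r\<^sup>2 * real N) \<le> (\<Sum>y\<in>{y \<in> reach 0 N. (1 / real N) *\<^sub>R real_site y \<in> cball (vel, 1) r}. tilted_mean N y)"
proof -
  let ?T = "{y \<in> reach 0 N. (1 / real N) *\<^sub>R real_site y \<in> cball (vel, 1) r}"
  have "(\<Sum>y\<in>reach 0 N - ?T. tilted_mean N y) \<le>
      (\<Sum>y\<in>reach 0 N - ?T. tilted_mean N y * (of_int (fst y) - real N * vel)\<^sup>2 / (r * real N)\<^sup>2)"
  proof (rule sum_mono)
    fix y assume y: "y \<in> reach 0 N - ?T"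
    then have "snd y = int N" by (simp add: mem_reach)
    moreover have "r < dist (vel, 1) ((1 / real N) *\<^sub>R real_site y)"
      using y by auto
    ultimately have "r < \<bar>vel - of_int (fst y) / real N\<bar>"
      using N by (simp add: dist_Pair_Pair real_site_def dist_real_def)
    then have "r * real N < \<bar>vel - of_int (fst y) / real N\<bar> * real N"
      using N by (intro mult_strict_right_mono) auto
    also have "\<dots> = \<bar>(vel - of_int (fst y) / real N) * real N\<bar>" by (simp add: abs_mult)
    also have "(vel - of_int (fst y) / real N) * real N = - (of_int (fst y) - real N * vel)"
      using N by (simp add: field_simps)
    finally have "\<bar>r * real N\<bar> \<le> \<bar>of_int (fst y) - real N * vel\<bar>" using r by simp
    then have "(r * real N)\<^sup>2 \<le> (of_int (fst y) - real N * vel)\<^sup>2"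
      by (simp only: abs_le_square_iff)
    then have "1 \<le> (of_int (fst y) - real N * vel)\<^sup>2 / (r * real N)\<^sup>2"
      using r N by (simp add: le_divide_eq)
    from mult_left_mono[OF this tilted_mean_nonneg[of N y]]
    show "tilted_mean N y \<le> tilted_mean N y * (of_int (fst y) - real N * vel)\<^sup>2 / (r * real N)\<^sup>2"
      by simp
  qed
  also have "\<dots> \<le> (\<Sum>y\<in>reach 0 N. tilted_mean N y * (of_int (fst y) - real N * vel)\<^sup>2 / (r * real N)\<^sup>2)"
    using tilted_mean_nonneg by (intro sum_mono2) auto
  also have "\<dots> \<le> 4 * real N / (r * real N)\<^sup>2"
    unfolding sum_divide_distrib[symmetric] by (intro divide_right_mono tilted_second_moment) simp
  also have "\<dots> = 4 / (r\<^sup>2 * real N)" using N by (simp add: power2_eq_square)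
  finally have "(\<Sum>y\<in>reach 0 N - ?T. tilted_mean N y) \<le> 4 / (r\<^sup>2 * real N)" .
  moreover have "(\<Sum>y\<in>reach 0 N. tilted_mean N y) = 1"
    using sum_pass_const[of "\<lambda>_ z. tilt \<theta> z * mean_step z" 0 N] c_mean by simp
  moreover have "(\<Sum>y\<in>reach 0 N. tilted_mean N y) = (\<Sum>y\<in>reach 0 N - ?T. tilted_mean N y) + (\<Sum>y\<in>?T. tilted_mean N y)"
    by (rule sum.subset_diff) auto
  ultimately show ?thesis by simp
qed

lemma eventually_chebyshev_half:
  assumes r: "0 < r"
  shows "\<forall>\<^sub>F N in sequentially. 1 / 2 \<le>
    (\<Sum>y\<in>{y \<in> reach 0 N. (1 / real N) *\<^sub>R real_site y \<in> cball (vel, 1) r}. tilted_mean N y)"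
proof -
  have "(\<lambda>N. 1 - 4 / (r\<^sup>2 * real N)) \<longlonglongrightarrow> 1" using r by real_asymp
  then have "\<forall>\<^sub>F N in sequentially. 1 / 2 < 1 - 4 / (r\<^sup>2 * real N)"
    by (rule order_tendstoD) simp
  then show ?thesis
    using eventually_ge_at_top[of 1]
    by eventually_elim (use tilted_chebyshev[OF r] in \<open>meson less_imp_le order_trans\<close>)
qed

lemma averaged_rate_le:
  assumes Ia: "averaged_rate_function P I"
  shows "I (vel, 1) \<le> ereal (\<theta> * vel - ln (mgf \<theta>))"
proof (rule rate_le_if_nearby)
  show "convex_rate_function I" using Ia by (simp add: averaged_rate_function_def)
  fix r :: real assume r: "0 < r"
  let ?F = "cball (vel, 1) r"
  let ?Q = "\<lambda>n. distr (averaged_law P 0) borel (empirical_velocity n)"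
  define b where "b = ln (mgf \<theta>) - \<theta> * vel - \<bar>\<theta>\<bar> * r - r"
  have "(\<lambda>N. exp (- (r * real N))) \<longlonglongrightarrow> 0" using r by real_asymp
  then have "\<forall>\<^sub>F N in sequentially. exp (- (r * real N)) < 1 / 2"
    by (rule order_tendstoD) simp
  then have "\<forall>\<^sub>F N in sequentially. ereal b \<le> ereal (1 / real N) * ln_ereal (measure (?Q N) ?F)"
    using eventually_chebyshev_half[OF r] eventually_ge_at_top[of 1]
  proof eventually_elim
    case (elim N)
    let ?T = "{y \<in> reach 0 N. (1 / real N) *\<^sub>R real_site y \<in> ?F}"
    let ?c = "mgf \<theta> ^ N * exp (real N * (- \<theta> * vel - \<bar>\<theta>\<bar> * r))"
    have "exp (real N * b) = ?c * exp (- (r * real N))"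
    proof -
      have "mgf \<theta> ^ N = exp (real N * ln (mgf \<theta>))"
        using mgf_pos[of \<theta>] by (simp add: exp_of_nat_mult)
      then show ?thesis by (simp add: b_def exp_add[symmetric] algebra_simps)
    qed
    also have "\<dots> \<le> ?c * (\<Sum>y\<in>?T. tilted_mean N y)"
      using elim mgf_pos[of \<theta>] by (intro mult_left_mono) auto
    also have "\<dots> \<le> (\<Sum>y\<in>?T. pass (\<lambda>_. mean_step) 0 N y)"
      unfolding sum_distrib_left
    proof (rule sum_mono)
      fix y assume y: "y \<in> ?T"
      have "dist (fst (vel, 1 :: real)) (fst ((1 / real N) *\<^sub>R real_site y)) \<le> r"
        using y by (intro order_trans[OF dist_fst_le]) simp
      then have "\<bar>of_int (fst y) / real N - vel\<bar> \<le> r"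
        by (simp add: real_site_def dist_real_def abs_minus_commute)
      then have "\<theta> * (of_int (fst y) / real N - vel) \<le> \<bar>\<theta>\<bar> * r"
        by (metis abs_ge_self abs_ge_zero abs_mult mult_left_mono order_trans)
      then have "real N * (\<theta> * (of_int (fst y) / real N - vel)) \<le> real N * (\<bar>\<theta>\<bar> * r)"
        by (intro mult_left_mono) auto
      moreover have "real N * (\<theta> * (of_int (fst y) / real N - vel)) = \<theta> * of_int (fst y) - real N * (\<theta> * vel)"
        using elim by (simp add: field_simps)
      ultimately have "real N * (- \<theta> * vel - \<bar>\<theta>\<bar> * r) \<le> - \<theta> * of_int (fst y)"
        by (simp add: algebra_simps)
      then show "?c * tilted_mean N y \<le> pass (\<lambda>_. mean_step) 0 N y"
        unfolding pass_eq_tilted[of "\<lambda>_. mean_step"] using mgf_pos[of \<theta>] tilted_mean_nonneg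
        by (intro mult_right_mono mult_left_mono) auto
    qed
    also have "\<dots> = measure (?Q N) ?F"
      by (rule measure_averaged_velocity(1)[symmetric]) simp
    finally show ?case by (rule ln_ereal_ge) (use elim in simp)
  qed
  then have "ereal b \<le> limsup (\<lambda>N. ereal (1 / real N) * ln_ereal (measure (?Q N) ?F))"
    by (intro le_Limsup) auto
  then have "(INF x\<in>?F. I x) \<le> ereal (- b)"
    using Ia by (intro LDP_closed[OF _ closed_cball]) (simp_all add: averaged_rate_function_def)
  then show "(INF x\<in>?F. I x) \<le> ereal (\<theta> * vel - ln (mgf \<theta>) + (\<bar>\<theta>\<bar> + 1) * r)"
    by (simp add: b_def algebra_simps)
qed

end

context iid_env
begin

text \<open>A quenched rate that is positive near \<open>\<xi>\<close> makes the quenched probabilities of a neighbourhood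
  tend to 0, hence by dominated convergence also their averages.\<close>
lemma quenched_rate_le_0:
  assumes Iq: "quenched_rate_function P I"
    and avg: "\<And>r. 0 < r \<Longrightarrow> \<forall>\<^sub>F n in sequentially.
      1 / 2 \<le> measure (distr (averaged_law P 0) borel (empirical_velocity n)) (cball \<xi> r)"
  shows "I \<xi> \<le> ereal 0"
proof (rule rate_le_if_nearby)
  show "convex_rate_function I" using Iq by (simp add: quenched_rate_function_def)
  fix r :: real assume r: "0 < r"
  let ?F = "cball \<xi> r"
  let ?Q = "\<lambda>\<omega> n. distr (quenched_law \<omega> 0) borel (empirical_velocity n)"
  let ?p = "\<lambda>n \<omega>. \<Sum>y\<in>{y \<in> reach 0 n. (1 / real n) *\<^sub>R real_site y \<in> ?F}. pass \<omega> 0 n y"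
  have p_eq: "measure (?Q \<omega> n) ?F = ?p n \<omega>" if "\<omega> \<in> space env_space" for \<omega> n
    by (rule measure_quenched_velocity[OF that]) simp
  show "(INF x\<in>?F. I x) \<le> ereal (0 + 0 * r)"
  proof (rule ccontr)
    assume "\<not> (INF x\<in>?F. I x) \<le> ereal (0 + 0 * r)"
    then have "ereal 0 < (INF x\<in>?F. I x)" by simp
    then obtain a :: real where a: "0 < a" "ereal a < (INF x\<in>?F. I x)"
      using ereal_dense2 ereal_less(2) by force
    have "AE \<omega> in P. (\<lambda>n. ?p n \<omega>) \<longlonglongrightarrow> 0"
    proof -
      have "AE \<omega> in P. satisfies_LDP (?Q \<omega>) I"
        using Iq by (simp add: quenched_rate_function_def)
      then show ?thesis
      proof (rule AE_mp, intro AE_I2 impI)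
        fix \<omega> assume "\<omega> \<in> space P" and LDP: "satisfies_LDP (?Q \<omega>) I"
        then have \<omega>: "\<omega> \<in> space env_space" by (simp add: space_P)
        have "limsup (\<lambda>n. ereal (1 / real n) * ln_ereal (measure (?Q \<omega> n) ?F)) < ereal (- a)"
        proof (rule ccontr)
          assume "\<not> ?thesis"
          then have "(INF x\<in>?F. I x) \<le> ereal (- (- a))"
            by (intro LDP_closed[OF LDP closed_cball]) simp
          then show False using a by simp
        qed
        then have "\<forall>\<^sub>F n in sequentially. ereal (1 / real n) * ln_ereal (measure (?Q \<omega> n) ?F) < ereal (- a)"
          by (rule Limsup_lessD)
        then have upper: "\<forall>\<^sub>F n in sequentially. ?p n \<omega> \<le> exp (- (a * real n))"
          using eventually_ge_at_top[of 1]
        proof eventually_elim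
          case (elim n)
          show ?case
          proof (rule ccontr)
            assume "\<not> ?case"
            then have "exp (real n * (- a)) \<le> measure (?Q \<omega> n) ?F"
              by (simp add: p_eq[OF \<omega>] mult.commute)
            from ln_ereal_ge[OF this elim(2)] elim(1) show False by simp
          qed
        qed
        have nonneg: "\<forall>\<^sub>F n in sequentially. 0 \<le> ?p n \<omega>"
          by (intro always_eventually allI sum_nonneg pass_nonneg env_nonneg[OF \<omega>])
        have "(\<lambda>n. exp (- (a * real n))) \<longlonglongrightarrow> 0"
          using a(1) by real_asymp
        then show "(\<lambda>n. ?p n \<omega>) \<longlonglongrightarrow> 0"
          by (rule real_tendsto_sandwich[OF nonneg upper tendsto_const])
      qed
    qed
    moreover have "?p n \<in> borel_measurable P" for n
      using local_fun_pass[of 0 n "\<lambda>_. 1", THEN local_fun_measurable]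
      by (intro borel_measurable_sum) (simp add: measurable_P)
    moreover have "AE \<omega> in P. norm (?p n \<omega>) \<le> 1" for n
    proof (rule AE_I2)
      fix \<omega> assume "\<omega> \<in> space P"
      then have \<omega>: "\<omega> \<in> space env_space" by (simp add: space_P)
      have nonneg: "0 \<le> pass \<omega> 0 n y" for y by (intro pass_nonneg env_nonneg[OF \<omega>])
      then have "?p n \<omega> \<le> (\<Sum>y\<in>reach 0 n. pass \<omega> 0 n y)" by (intro sum_mono2) auto
      also have "\<dots> = 1" by (rule sum_pass_const) (rule env_sum[OF \<omega>])
      finally show "norm (?p n \<omega>) \<le> 1" using nonneg by (simp add: sum_nonneg)
    qed
    ultimately have "(\<lambda>n. expectation (?p n)) \<longlonglongrightarrow> expectation (\<lambda>_. 0)"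
      by (intro integral_dominated_convergence[where w = "\<lambda>_. 1"]) auto
    then have "\<forall>\<^sub>F n in sequentially. expectation (?p n) < 1 / 2"
      by (intro order_tendstoD) auto
    moreover have "measure (distr (averaged_law P 0) borel (empirical_velocity n)) ?F = expectation (?p n)" for n
      by (subst measure_averaged_velocity(2), simp, intro Bochner_Integration.integral_cong refl p_eq)
         (simp add: space_P)
    ultimately have "\<forall>\<^sub>F n in sequentially. measure (distr (averaged_law P 0) borel (empirical_velocity n)) ?F < 1 / 2"
      by (simp only:)
    then have "\<forall>\<^sub>F n in sequentially. False"
      using avg[OF r] by eventually_elim linarith
    then show False by simp
  qed
qed

lemma pass_straight_ge:
  assumes K: "\<And>u z. z \<in> steps \<Longrightarrow> 0 \<le> K z" and z: "z \<in> steps"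
  shows "K z ^ n \<le> pass (\<lambda>_. K) 0 n (int n * fst z, int n)"
proof (induction n)
  case (Suc n)
  have "(int (Suc n) * fst z, int (Suc n)) - z = (int n * fst z, int n)"
    using z by (auto simp: steps_def algebra_simps)
  then have "K z ^ Suc n \<le> pass (\<lambda>_. K) 0 n ((int (Suc n) * fst z, int (Suc n)) - z) * K z"
    using Suc K[OF z] by (simp add: mult.commute mult_left_mono)
  also have "\<dots> \<le> pass (\<lambda>_. K) 0 (Suc n) (int (Suc n) * fst z, int (Suc n))"
    unfolding pass.simps
    by (rule member_le_sum[OF z]) (auto intro!: mult_nonneg_nonneg pass_nonneg K)
  finally show ?case .
qed (simp add: zero_prod_def)

lemma averaged_rate_endpoint_le:
  assumes Ia: "averaged_rate_function P I" and z: "z \<in> steps" and pos: "0 < mean_step z"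
  shows "I (of_int (fst z), 1) \<le> ereal (- ln (mean_step z))"
proof -
  let ?F = "{(of_int (fst z), 1)} :: (real \<times> real) set"
  let ?Q = "\<lambda>n. distr (averaged_law P 0) borel (empirical_velocity n)"
  have "\<forall>\<^sub>F n in sequentially. ereal (ln (mean_step z)) \<le> ereal (1 / real n) * ln_ereal (measure (?Q n) ?F)"
    using eventually_ge_at_top[of 1]
  proof eventually_elim
    case (elim n)
    let ?y = "(int n * fst z, int n)"
    let ?T = "{y \<in> reach 0 n. (1 / real n) *\<^sub>R real_site y \<in> ?F}"
    have "exp (real n * ln (mean_step z)) = mean_step z ^ n"
      using pos by (simp add: exp_of_nat_mult)
    also have "\<dots> \<le> pass (\<lambda>_. mean_step) 0 n ?y"
      by (rule pass_straight_ge) (auto intro: mean_step_nonneg z)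
    also have "\<dots> \<le> (\<Sum>y\<in>?T. pass (\<lambda>_. mean_step) 0 n y)"
    proof (rule member_le_sum)
      have "\<bar>fst z\<bar> = 1" using z by (auto simp: steps_def)
      then show "?y \<in> ?T" using elim by (auto simp: mem_reach real_site_def abs_mult)
    qed (auto intro: pass_nonneg mean_step_nonneg)
    also have "\<dots> = measure (?Q n) ?F"
      by (rule measure_averaged_velocity(1)[symmetric]) simp
    finally show ?case by (rule ln_ereal_ge) (use elim in simp)
  qed
  then have "ereal (ln (mean_step z)) \<le> limsup (\<lambda>n. ereal (1 / real n) * ln_ereal (measure (?Q n) ?F))"
    by (intro le_Limsup) auto
  then have "(INF x\<in>?F. I x) \<le> ereal (- ln (mean_step z))"
    using Ia by (intro LDP_closed[where Q = ?Q]) (simp_all add: averaged_rate_function_def)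
  then show ?thesis by simp
qed

lemma averaged_rate_finite_imp:
  assumes Ia: "averaged_rate_function P I" and fin: "I \<xi> < \<infinity>"
  shows "snd \<xi> = 1" "\<bar>fst \<xi>\<bar> \<le> 1"
proof -
  let ?G = "{x :: real \<times> real. snd x \<noteq> 1 \<or> 1 < \<bar>fst x\<bar>}"
  let ?Q = "\<lambda>n. distr (averaged_law P 0) borel (empirical_velocity n)"
  have G: "open ?G"
    by (intro open_Collect_disj open_Collect_neq open_Collect_less continuous_intros)
  have null: "measure (?Q n) ?G = 0" if n: "1 \<le> n" for n
  proof -
    have "(1 / real n) *\<^sub>R real_site y \<notin> ?G" if "y \<in> reach 0 n" for y
    proof -
      have "\<bar>fst y\<bar> \<le> int n" "snd y = int n" using that by (auto simp: mem_reach)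
      then have "\<bar>real_of_int (fst y)\<bar> \<le> real n" "real_of_int (snd y) = real n" by linarith+
      then show ?thesis using n by (simp add: real_site_def divide_le_eq abs_divide)
    qed
    then have "{y \<in> reach 0 n. (1 / real n) *\<^sub>R real_site y \<in> ?G} = {}" by blast
    then show ?thesis
      using measure_averaged_velocity(1)[OF borel_open[OF G], of 0 n] by (simp only: sum.empty)
  qed
  have "\<xi> \<notin> ?G"
  proof
    assume \<xi>: "\<xi> \<in> ?G"
    have "ereal (- b) \<le> I \<xi>" for b
    proof -
      have "\<forall>\<^sub>F n in sequentially. ereal (1 / real n) * ln_ereal (measure (?Q n) ?G) \<le> ereal b"
        using eventually_ge_at_top[of 1]
        by eventually_elim (rule ln_ereal_le, simp_all only: null, simp_all)
      then have "liminf (\<lambda>n. ereal (1 / real n) * ln_ereal (measure (?Q n) ?G)) \<le> ereal b"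
        by (intro Liminf_le) auto
      then have "ereal (- b) \<le> (INF x\<in>?G. I x)"
        using Ia by (intro LDP_open[OF _ G]) (simp_all add: averaged_rate_function_def)
      also have "\<dots> \<le> I \<xi>" by (rule INF_lower[OF \<xi>])
      finally show ?thesis .
    qed
    from this[of "- c" for c] have "ereal c \<le> I \<xi>" for c by simp
    then have "I \<xi> = \<infinity>" by (rule ereal_top)
    then show False using fin by simp
  qed
  then show "snd \<xi> = 1" "\<bar>fst \<xi>\<bar> \<le> 1" by auto
qed

lemma mean_step_minus: "mean_step (-1, 1) = 1 - mean_step (1, 1)"
  using sum_mean_step unfolding sum_steps by simp

lemma lln_velocity_eq: "lln_velocity P = (mean_step (1, 1) - mean_step (-1, 1), 1)"
  using sum_mean_step unfolding lln_velocity_def sum_steps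
  by (simp add: real_site_def scaleR_prod_def plus_prod_def)

lemma mean_step_pos:
  assumes "uniformly_elliptic P" and z: "z \<in> steps"
  shows "0 < mean_step z"
proof -
  obtain \<kappa> where \<kappa>: "0 < \<kappa>" "AE \<omega> in P. \<kappa> \<le> \<omega> 0 z"
    using assms unfolding uniformly_elliptic_def by blast
  have "integrable P (\<lambda>\<omega>. \<omega> 0 z)"
    by (rule local_fun_integrable[OF local_fun_env[OF z UNIV_I]])
  then have "expectation (\<lambda>_. \<kappa>) \<le> mean_step z"
    using \<kappa>(2) by (intro integral_mono_AE) auto
  then show ?thesis using \<kappa>(1) by (simp add: prob_space)
qed

lemma AE_const_imp_deterministic:
  assumes AE: "AE \<omega> in P. \<omega> 0 z = a" and z: "z \<in> steps"
  shows "deterministic P"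
proof -
  define p where "p = restrict (\<lambda>w. if w = z then a else 1 - a) steps"
  have "AE \<omega> in P. \<omega> 0 = p"
    using AE
  proof (rule AE_mp, intro AE_I2 impI)
    fix \<omega> assume "\<omega> \<in> space P" and a: "\<omega> 0 z = a"
    then have pv: "\<omega> 0 \<in> prob_vectors" using env_space_prob_vector by (simp add: space_P)
    show "\<omega> 0 = p"
    proof
      fix w
      show "\<omega> 0 w = p w"
      proof (cases "w \<in> steps")
        case True
        have "\<omega> 0 (1, 1) + \<omega> 0 (-1, 1) = 1"
          using pv by (simp add: prob_vectors_def sum_steps)
        then show ?thesis using True z a by (auto simp: p_def steps_def)
      next
        case False
        have "\<omega> 0 \<in> extensional steps" using pv by (simp add: prob_vectors_def)
        from extensional_arb[OF this False] show ?thesis using False by (simp add: p_def)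
      qed
    qed
  qed
  then show ?thesis unfolding deterministic_def by blast
qed

lemma sqrt_mean_less:
  assumes nd: "\<not> deterministic P" and z: "z \<in> steps"
  shows "expectation (\<lambda>\<omega>. sqrt (\<omega> 0 z)) < sqrt (mean_step z)"
proof -
  let ?A = "expectation (\<lambda>\<omega>. sqrt (\<omega> 0 z))"
  have loc: "local_fun UNIV (\<lambda>\<omega>. \<omega> 0 z)" by (rule local_fun_env[OF z UNIV_I])
  note int = local_fun_integrable[OF loc] local_fun_integrable[OF local_fun_sqrt[OF loc]]
  have eq: "(sqrt (\<omega> 0 z) - ?A)\<^sup>2 = \<omega> 0 z - 2 * ?A * sqrt (\<omega> 0 z) + ?A\<^sup>2" if "\<omega> \<in> space P" for \<omega>
    using that env_nonneg[of \<omega> z 0] z by (simp add: power2_diff space_P)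
  have int2: "integrable P (\<lambda>\<omega>. (sqrt (\<omega> 0 z) - ?A)\<^sup>2)"
    using int by (subst Bochner_Integration.integrable_cong[OF refl eq]) auto
  have "expectation (\<lambda>\<omega>. (sqrt (\<omega> 0 z) - ?A)\<^sup>2) = mean_step z - ?A\<^sup>2"
    using int by (subst Bochner_Integration.integral_cong[OF refl eq]) (auto simp: prob_space power2_eq_square)
  moreover have "expectation (\<lambda>\<omega>. (sqrt (\<omega> 0 z) - ?A)\<^sup>2) \<noteq> 0"
  proof
    assume "expectation (\<lambda>\<omega>. (sqrt (\<omega> 0 z) - ?A)\<^sup>2) = 0"
    then have "AE \<omega> in P. (sqrt (\<omega> 0 z) - ?A)\<^sup>2 = 0"
      using int2 by (subst (asm) integral_nonneg_eq_0_iff_AE) auto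
    then have "AE \<omega> in P. \<omega> 0 z = ?A\<^sup>2"
    proof (rule AE_mp, intro AE_I2 impI)
      fix \<omega> assume "\<omega> \<in> space P" and "(sqrt (\<omega> 0 z) - ?A)\<^sup>2 = 0"
      then show "\<omega> 0 z = ?A\<^sup>2" using env_nonneg[of \<omega> z 0] z by (simp add: space_P) (metis real_sqrt_pow2)
    qed
    with AE_const_imp_deterministic[OF _ z] nd show False by blast
  qed
  moreover have "0 \<le> expectation (\<lambda>\<omega>. (sqrt (\<omega> 0 z) - ?A)\<^sup>2)" by simp
  ultimately have "?A\<^sup>2 < mean_step z" by simp
  then show ?thesis by (rule real_less_rsqrt)
qed

end

context tilted_iid_env
begin

lemma V_pos:
  assumes nd: "\<not> deterministic P" and \<theta>: "\<theta> \<noteq> 0"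
  shows "0 < V"
proof (rule ccontr)
  assume "\<not> 0 < V"
  then have "V = 0" using V_nonneg by simp
  moreover have "integrable P (\<lambda>\<omega>. (dev 0 \<omega>)\<^sup>2)"
    unfolding power2_eq_square by (rule local_fun_integrable[OF local_fun_mult[OF local_fun_dev local_fun_dev]])
  ultimately have "AE \<omega> in P. (dev 0 \<omega>)\<^sup>2 = 0"
    unfolding V_def by (subst (asm) integral_nonneg_eq_0_iff_AE) auto
  then have "AE \<omega> in P. \<omega> 0 (1, 1) = (1 - tilt \<theta> (-1, 1)) / (tilt \<theta> (1, 1) - tilt \<theta> (-1, 1))"
  proof (rule AE_mp, intro AE_I2 impI)
    fix \<omega> assume "\<omega> \<in> space P" and 0: "(dev 0 \<omega>)\<^sup>2 = 0"
    then have "\<omega> 0 (-1, 1) = 1 - \<omega> 0 (1, 1)"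
      using env_sum[of \<omega> 0] by (simp add: space_P sum_steps)
    with 0 have "(tilt \<theta> (1, 1) - tilt \<theta> (-1, 1)) * \<omega> 0 (1, 1) = 1 - tilt \<theta> (-1, 1)"
      by (simp add: dev_def sum_steps algebra_simps)
    moreover have "tilt \<theta> (1, 1) \<noteq> tilt \<theta> (-1, 1)"
      using \<theta> mgf_pos[of \<theta>] by (simp add: tilt_def)
    ultimately show "\<omega> 0 (1, 1) = (1 - tilt \<theta> (-1, 1)) / (tilt \<theta> (1, 1) - tilt \<theta> (-1, 1))"
      by (simp add: field_simps)
  qed
  then show False using AE_const_imp_deterministic nd by (auto simp: steps_def)
qed

lemma quenched_gt_averaged_interior:
  assumes nd: "\<not> deterministic P" and \<theta>: "\<theta> \<noteq> 0"
    and Iq: "quenched_rate_function P I_q" and Ia: "averaged_rate_function P I_a"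
  shows "I_a (vel, 1) < I_q (vel, 1)"
proof -
  obtain m \<rho> where m: "1 \<le> m" and \<rho>: "\<rho> < 1"
    "\<And>x. (\<Sum>y\<in>reach x m. expectation (\<lambda>\<omega>. sqrt (Z x m y \<omega>))) \<le> \<rho>"
    using fractional_moment_contraction[OF V_pos[OF nd \<theta>]] by blast
  obtain \<rho>' where \<rho>': "\<rho> < \<rho>'" "0 < \<rho>'" "\<rho>' < 1"
    using dense[of "max \<rho> 0" 1] \<rho>(1) by auto
  have "I_a (vel, 1) \<le> ereal (\<theta> * vel - ln (mgf \<theta>))"
    by (rule averaged_rate_le[OF Ia])
  also have "2 / real m * ln \<rho>' < 0"
    using m \<rho>' by (intro mult_pos_neg) auto
  then have "ereal (\<theta> * vel - ln (mgf \<theta>)) < ereal (\<theta> * vel - ln (mgf \<theta>) - 2 / real m * ln \<rho>')"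
    by simp
  also have "\<dots> \<le> I_q (vel, 1)"
    by (rule quenched_rate_ge[OF Iq m \<rho>(2) \<rho>'(1,2)])
  finally show ?thesis .
qed

end

context iid_env
begin

lemma quenched_gt_averaged_endpoint:
  assumes nd: "\<not> deterministic P" and z: "z \<in> steps" and pos: "0 < mean_step z"
    and Iq: "quenched_rate_function P I_q" and Ia: "averaged_rate_function P I_a"
  shows "I_a (of_int (fst z), 1) < I_q (of_int (fst z), 1)"
proof -
  define \<sigma> :: real where "\<sigma> = of_int (fst z)"
  have \<sigma>: "\<sigma> * \<sigma> = 1" using z by (auto simp: \<sigma>_def steps_def)
  let ?s = "\<lambda>z. expectation (\<lambda>\<omega>. sqrt (\<omega> 0 z))"
  obtain \<kappa> where \<kappa>: "?s z < \<kappa>" "\<kappa> < sqrt (mean_step z)"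
    using dense[OF sqrt_mean_less[OF nd z]] by blast
  have s_nonneg: "0 \<le> ?s w" if "w \<in> steps" for w
    by (intro integral_nonneg_AE AE_I2) (use that env_nonneg in \<open>auto simp: space_P\<close>)
  have \<kappa>0: "0 < \<kappa>" using s_nonneg[OF z] \<kappa>(1) by simp
  have "((\<lambda>t. ?s z + exp (- t) * ?s (- fst z, 1)) \<longlongrightarrow> ?s z + 0 * ?s (- fst z, 1)) at_top"
    by (intro tendsto_intros filterlim_compose[OF exp_at_bot] filterlim_uminus_at_bot_at_top)
  then have "\<forall>\<^sub>F t in at_top. ?s z + exp (- t) * ?s (- fst z, 1) < \<kappa>"
    using \<kappa>(1) by (intro order_tendstoD) auto
  then obtain t where t: "?s z + exp (- t) * ?s (- fst z, 1) < \<kappa>"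
    by (auto simp: eventually_at_top_linorder)
  interpret T: tilted_iid_env P "\<sigma> * t" by unfold_locales
  define \<rho>' where "\<rho>' = sqrt (exp t / mgf (\<sigma> * t)) * \<kappa>"
  have pos': "0 < exp t / mgf (\<sigma> * t)" using mgf_pos by simp
  define \<rho> where "\<rho> = sqrt (exp t / mgf (\<sigma> * t)) * (?s z + exp (- t) * ?s (- fst z, 1))"
  have \<rho>: "(\<Sum>y\<in>reach x 1. expectation (\<lambda>\<omega>. sqrt (T.Z x 1 y \<omega>))) = \<rho>" for x
  proof -
    have Z1: "T.Z x 1 (x + w) \<omega> = tilt (\<sigma> * t) w * \<omega> x w" if w: "w \<in> steps" for w \<omega>
    proof -
      have "T.Z x 1 (x + w) \<omega> = (\<Sum>w'\<in>steps. if w' = w then tilt (\<sigma> * t) w' * \<omega> x w' else 0)"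
        by (simp only: One_nat_def pass.simps, rule sum.cong) (auto simp: algebra_simps)
      then show ?thesis using w by simp
    qed
    have E1: "expectation (\<lambda>\<omega>. sqrt (T.Z x 1 (x + w) \<omega>)) = sqrt (tilt (\<sigma> * t) w) * ?s w" if w: "w \<in> steps" for w
    proof -
      have "(\<lambda>p. sqrt (p w)) \<in> borel_measurable prob_vector_space"
        using T.component_measurable[OF w] by measurable
      from expectation_site[OF this, of x] have "expectation (\<lambda>\<omega>. sqrt (\<omega> x w)) = ?s w" .
      then show ?thesis
        by (simp only: Z1[OF w] real_sqrt_mult integral_mult_right_zero)
    qed
    have "(\<Sum>y\<in>reach x 1. expectation (\<lambda>\<omega>. sqrt (T.Z x 1 y \<omega>))) =
        (\<Sum>y\<in>(+) x ` steps. expectation (\<lambda>\<omega>. sqrt (T.Z x 1 y \<omega>)))"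
    proof (rule sum.mono_neutral_right)
      show "(+) x ` steps \<subseteq> reach x 1" by (auto simp: mem_reach steps_def)
      show "\<forall>y\<in>reach x 1 - (+) x ` steps. expectation (\<lambda>\<omega>. sqrt (T.Z x 1 y \<omega>)) = 0"
      proof
        fix y assume y: "y \<in> reach x 1 - (+) x ` steps"
        have "y - w \<noteq> x" if "w \<in> steps" for w
          using y that by (metis DiffD2 add.commute diff_add_cancel image_eqI)
        then have "T.Z x 1 y \<omega> = 0" for \<omega> by simp
        then show "expectation (\<lambda>\<omega>. sqrt (T.Z x 1 y \<omega>)) = 0" by simp
      qed
    qed simp
    also have "\<dots> = (\<Sum>w\<in>steps. sqrt (tilt (\<sigma> * t) w) * ?s w)"
      by (subst sum.reindex) (simp_all only: inj_on_def o_def E1 add_left_cancel cong: sum.cong, simp)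
    also have "\<dots> = (\<Sum>w\<in>{z, (- fst z, 1)}. sqrt (tilt (\<sigma> * t) w) * ?s w)"
      by (rule sum.cong) (use z in \<open>auto simp: steps_def\<close>)
    also have "\<dots> = sqrt (tilt (\<sigma> * t) z) * ?s z + sqrt (tilt (\<sigma> * t) (- fst z, 1)) * ?s (- fst z, 1)"
      by (subst sum.insert) (use z in \<open>auto simp: steps_def\<close>)
    also have "tilt (\<sigma> * t) z = exp t / mgf (\<sigma> * t)"
      using \<sigma> by (simp add: tilt_def \<sigma>_def[symmetric] mult.commute mult.left_commute)
    also have "sqrt (tilt (\<sigma> * t) (- fst z, 1)) = sqrt (exp t / mgf (\<sigma> * t)) * exp (- t)"
    proof -
      have "\<sigma> * t * of_int (- fst z) = - t" using \<sigma> by (simp add: \<sigma>_def[symmetric] mult.commute mult.left_commute)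
      then have "tilt (\<sigma> * t) (- fst z, 1) = exp t / mgf (\<sigma> * t) * (exp (- t))\<^sup>2"
        by (simp add: tilt_def power2_eq_square exp_add[symmetric])
      then show ?thesis by (simp only: real_sqrt_mult real_sqrt_abs abs_exp_cancel)
    qed
    finally show ?thesis by (simp only: \<rho>_def distrib_left mult.assoc)
  qed
  have \<rho>_less: "\<rho> < \<rho>'"
    unfolding \<rho>_def \<rho>'_def using t pos' by (intro mult_strict_left_mono) auto
  have "I_a (\<sigma>, 1) \<le> ereal (- ln (mean_step z))"
    unfolding \<sigma>_def by (rule averaged_rate_endpoint_le[OF Ia z pos])
  also have "- ln (mean_step z) < - 2 * ln \<kappa>"
  proof -
    have "\<kappa>\<^sup>2 < mean_step z"
      using \<kappa> \<kappa>0 pos real_sqrt_less_iff[of "\<kappa>\<^sup>2" "mean_step z"] by simp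
    then have "ln (\<kappa>\<^sup>2) < ln (mean_step z)" using \<kappa>0 pos by (subst ln_less_cancel_iff) auto
    then show ?thesis using \<kappa>0 by (simp add: ln_realpow)
  qed
  also have "- 2 * ln \<kappa> = \<sigma> * t * \<sigma> - ln (mgf (\<sigma> * t)) - 2 / real 1 * ln \<rho>'"
  proof -
    have "2 * ln (sqrt (exp t / mgf (\<sigma> * t))) = t - ln (mgf (\<sigma> * t))"
      using pos' mgf_pos[of "\<sigma> * t"] by (simp add: ln_sqrt ln_div)
    moreover have "\<sigma> * t * \<sigma> = t" using \<sigma> by (simp add: mult.commute mult.left_commute)
    moreover have "ln \<rho>' = ln (sqrt (exp t / mgf (\<sigma> * t))) + ln \<kappa>"
      unfolding \<rho>'_def using pos' \<kappa>0 by (intro ln_mult_pos) auto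
    ultimately show ?thesis by simp
  qed
  also have "ereal (\<sigma> * t * \<sigma> - ln (mgf (\<sigma> * t)) - 2 / real 1 * ln \<rho>') \<le> I_q (\<sigma>, 1)"
  proof (rule T.quenched_rate_ge[OF Iq _ _ \<rho>_less])
    show "0 < \<rho>'" unfolding \<rho>'_def using pos' \<kappa>0 by simp
  qed (simp_all only: \<rho> order_refl)
  finally show ?thesis by (simp add: \<sigma>_def)
qed

lemma ex_tilt_vel:
  assumes v: "\<bar>v\<bar> < 1" and pos: "\<And>z. z \<in> steps \<Longrightarrow> 0 < mean_step z"
  obtains \<theta> where "weighted_iid_env.vel P (tilt \<theta>) = v"
proof -
  let ?p = "mean_step (1, 1)" and ?q = "mean_step (-1, 1)"
  have pq: "0 < ?p" "0 < ?q" using pos by (auto simp: steps_def)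
  define \<theta> where "\<theta> = ln ((1 + v) * ?q / ((1 - v) * ?p)) / 2"
  interpret T: tilted_iid_env P \<theta> by unfold_locales
  define a where "a = exp \<theta>"
  have a: "0 < a" by (simp add: a_def)
  have "a * a = exp (2 * \<theta>)" by (simp add: a_def exp_add[symmetric])
  also have "\<dots> = (1 + v) * ?q / ((1 - v) * ?p)"
    using v pq by (simp add: \<theta>_def)
  finally have "a * a * ((1 - v) * ?p) = (1 + v) * ?q"
    using v pq by simp
  moreover have "(a * a * ?p - ?q) - v * (a * a * ?p + ?q) = a * a * ((1 - v) * ?p) - (1 + v) * ?q"
    by (simp add: algebra_simps)
  ultimately have "a * a * ?p - ?q = v * (a * a * ?p + ?q)"
    by linarith
  moreover have "a * ?p - ?q / a = (a * a * ?p - ?q) / a" "a * ?p + ?q / a = (a * a * ?p + ?q) / a"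
    using a by (simp_all add: field_simps)
  ultimately have eq: "a * ?p - ?q / a = v * (a * ?p + ?q / a)"
    by simp
  have mgf: "mgf \<theta> = a * ?p + ?q / a"
    by (simp add: mgf_def sum_steps a_def exp_minus divide_inverse mult.commute)
  have "T.vel = a * ?p / mgf \<theta> - ?q / a / mgf \<theta>"
    by (simp add: T.vel_def sum_steps tilt_def a_def exp_minus inverse_eq_divide)
  also have "\<dots> = (a * ?p - ?q / a) / mgf \<theta>"
    by (rule diff_divide_distrib[symmetric])
  also have "a * ?p - ?q / a = v * mgf \<theta>"
    using eq mgf by simp
  finally have "T.vel = v"
    using mgf_pos[of \<theta>] by simp
  then show ?thesis by (rule that)
qed

lemma rates_at_lln_velocity:
  assumes Iq: "quenched_rate_function P I_q" and Ia: "averaged_rate_function P I_a"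
  shows "I_q (lln_velocity P) = 0" "I_a (lln_velocity P) = 0"
proof -
  interpret T: tilted_iid_env P 0 by unfold_locales
  have mgf: "mgf 0 = 1" by (simp add: mgf_def sum_mean_step)
  have vel: "(T.vel, 1) = lln_velocity P"
    by (simp add: T.vel_def lln_velocity_eq sum_steps tilt_def mgf)
  have mean: "(\<lambda>_ z. tilt 0 z * mean_step z) = (\<lambda>_. mean_step)"
    by (simp add: tilt_def mgf)
  have "I_a (lln_velocity P) \<le> ereal 0"
    using T.averaged_rate_le[OF Ia] by (simp add: vel mgf)
  moreover have "0 \<le> I_a x" for x
    using Ia unfolding averaged_rate_function_def convex_rate_function_def by blast
  ultimately show "I_a (lln_velocity P) = 0"
    by (simp add: antisym flip: zero_ereal_def)
  have "I_q (lln_velocity P) \<le> ereal 0"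
  proof (rule quenched_rate_le_0[OF Iq])
    show "\<forall>\<^sub>F n in sequentially. 1 / 2 \<le>
        measure (distr (averaged_law P 0) borel (empirical_velocity n)) (cball (lln_velocity P) r)" if "0 < r" for r
      using T.eventually_chebyshev_half[OF that]
      by eventually_elim (subst measure_averaged_velocity(1), simp_all add: mean vel)
  qed
  moreover have "0 \<le> I_q x" for x
    using Iq unfolding quenched_rate_function_def convex_rate_function_def by blast
  ultimately show "I_q (lln_velocity P) = 0"
    by (simp add: antisym flip: zero_ereal_def)
qed

end

theorem theorem1p5:
  fixes P :: "env measure" and I_q I_a :: "real \<times> real \<Rightarrow> ereal" and \<xi> :: "real \<times> real"
  assumes "iid_environment P"
    and "uniformly_elliptic P"
    and "\<not> deterministic P"
    and "quenched_rate_function P I_q"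
    and "averaged_rate_function P I_a"
  shows "(I_q \<xi> = I_a \<xi> \<and> I_a \<xi> < \<infinity>) \<longleftrightarrow> \<xi> = lln_velocity P"
proof -
  interpret iid_env P by unfold_locales fact
  note pos = mean_step_pos[OF assms(2)]
  have "\<xi> = lln_velocity P" if eq: "I_q \<xi> = I_a \<xi>" and fin: "I_a \<xi> < \<infinity>"
  proof (rule ccontr)
    assume ne: "\<xi> \<noteq> lln_velocity P"
    have \<xi>: "\<xi> = (fst \<xi>, 1)" and le: "\<bar>fst \<xi>\<bar> \<le> 1"
      using averaged_rate_finite_imp[OF assms(5) fin] by (auto simp: prod_eq_iff)
    have "I_a \<xi> < I_q \<xi>"
    proof (cases "\<bar>fst \<xi>\<bar> < 1")
      case True
      obtain \<theta> where vel: "weighted_iid_env.vel P (tilt \<theta>) = fst \<xi>"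
        using ex_tilt_vel[OF True pos] by blast
      interpret T: tilted_iid_env P \<theta> by unfold_locales
      have "\<theta> \<noteq> 0"
      proof
        assume "\<theta> = 0"
        then have "T.vel = fst (lln_velocity P)"
          unfolding T.vel_def
          by (simp add: lln_velocity_eq sum_steps tilt_def mgf_def sum_mean_step mean_step_minus)
        then show False using ne \<xi> vel by (simp add: lln_velocity_eq prod_eq_iff)
      qed
      from T.quenched_gt_averaged_interior[OF assms(3) this assms(4,5)] show ?thesis
        by (simp only: vel \<xi>[symmetric])
    next
      case False
      define z :: site where "z = (if fst \<xi> = 1 then (1, 1) else (-1, 1))"
      have z: "z \<in> steps" "fst \<xi> = of_int (fst z)"
        using False le by (auto simp: z_def steps_def)
      from quenched_gt_averaged_endpoint[OF assms(3) z(1) pos[OF z(1)] assms(4,5)] show ?thesis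
        by (simp only: z(2)[symmetric] \<xi>[symmetric])
    qed
    then show False using eq by simp
  qed
  then show ?thesis using rates_at_lln_velocity[OF assms(4,5)] by auto
qed

end
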